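(* Consider the quadratic program $$\min_{q_G\in\mathbb{R}^{m-1}}\ \tfrac12 q_G^T M q_G + q_G^T N q_L\quad\text{subject to}\quad \Phi q_G+b\le 0,$$ assumed feasible, with $$\Phi=\begin{bmatrix}-\sin\theta\,M\\ \sin\theta\,M\end{bmatrix},\qquad b=\begin{bmatrix}b_{\min}\\-b_{\max}\end{bmatrix},$$ and let $q_G^*$ be its optimal solution. Let $\gamma>0$ and let $h(t)$, $t=0,1,2,\dots$, be the random sequence of triggered agents, an i.i.d. sequence uniformly distributed on $\mathcal{C}\setminus\{0\}$. Consider the random dynamical system with state $(q_G(t),\nu(t))$, $\nu=[\lambda_{\min}^T\ \lambda_{\max}^T]^T$, in which, at each $t$, with $h=h(t)$, $$\lambda_{\min,h}(t+1)=\Big[\lambda_{\min,h}(t)+\gamma\tfrac{2}{U_N^2}\mathbf{1}_h^T\big(b_{\min}-\sin\theta\,Mq_G(t)\big)\Big]_+,$$ $$\lambda_{\max,h}(t+1)=\Big[\lambda_{\max,h}(t)+\gamma\tfrac{2}{U_N^2}\mathbf{1}_h^T\big(\sin\theta\,Mq_G(t)-b_{\max}\big)\Big]_+,$$ $$q_h(t+1)=-\mathbf{1}_h^T\big(M^{-1}Nq_L+M^{-1}\Phi^T\nu(t+1)\big),$$ while $\lambda_{\min,k}(t+1)=\lambda_{\min,k}(t)$, $\lambda_{\max,k}(t+1)=\lambda_{\max,k}(t)$, $q_k(t+1)=q_k(t)$ for all $k\neq h(t)$. Then $t\mapsto q_G(t)$ converges almost surely to $q_G^*$ if $$\gamma\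le\frac{U_N^2}{2\sin^2\theta\,\sigma_{\max}}.$$
   Context: Let $\mathcal{G}$ be a connected directed graph (connectedness in the undirected sense) with node set $\mathcal{V}$, $|\mathcal{V}|=n$, edge set $\mathcal{E}$, and incidence matrix $A\in\{0,\pm1\}^{|\mathcal{E}|\times n}$ ($[A]_{ev}=-1$ if $v$ is the source of $e$, $+1$ if $v$ is the target of $e$, $0$ otherwise). Each edge $e$ has an impedance $z_e=e^{j\theta}|z_e|$, $|z_e|>0$, with the same angle $\theta\in\mathbb{R}$ for all edges; $\sin\theta\neq0$. Put $Z=\mathrm{diag}(|z_e|,e\in\mathcal{E})$ and $L=A^TZ^{-1}A$. A subset $\mathcal{C}\subseteq\mathcal{V}$ of agents with $|\mathcal{C}|=m$ contains a distinguished node $0$; nodes in $\mathcal{C}\setminus\{0\}$ are microgenerators, nodes in $\mathcal{V}\setminus\mathcal{C}$ are loads, and nodes are ordered as: $0$, microgenerators, loads. $\mathbf{1}$ is the all-ones vector and $\mathbf{1}_h$ the canonical vector with $1$ in the position of $h$. There is a unique symmetric positive semidefinite $X\in\mathbb{R}^{n\times n}$ with $XL=I-\mathbf{1}\mathbf{1}_0^T$ and $X\mathbf{1}_0=0$; in blocks, $$X=\begin{bmatrix}0&0&0\\0&M&N\\0&N^T&Q\end{bmatrix},$$ with $M\in\mathbb{R}^{(m-1)\times(m-1)}$ and $N\in\mathbb{R}^{(m-1)\times(n-m)}$. $\sigma_{\max}$ is the largest eigenvalue of $M$. Fixed data: $p_G\in\mathbb{R}^{m-1}$, $p_L,q_L\in\mathbb{R}^{n-m}$,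 nominal voltage $U_N>0$, voltage bounds $U_{\min},U_{\max}$, $v_{\min}=U_{\min}^2/U_N^2$, $v_{\max}=U_{\max}^2/U_N^2$, and $$b_{\min}=\tfrac{U_N^2}{2}(v_{\min}-1)\mathbf{1}-\big(Mp_G\cos\theta+N(p_L\cos\theta+q_L\sin\theta)\big),$$ $$b_{\max}=\tfrac{U_N^2}{2}(v_{\max}-1)\mathbf{1}-\big(Mp_G\cos\theta+N(p_L\cos\theta+q_L\sin\theta)\big).$$ $[\cdot]_+$ denotes projection on the nonnegative half-line. The sequence $h(t)$ arises because each agent in $\mathcal{C}\setminus\{0\}$ is triggered by its own uncoordinated timer with exponentially distributed waiting times, identically distributed for all agents; $h(t)$ is the agent triggered at iteration $t$, so $h(t)$ is i.i.d. uniform on $\mathcal{C}\setminus\{0\}$.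
   Formalization: If the voltage bounds coincide (U_min² = U_max²), γ is required to be strictly below the stated bound; at equality the claim fails (M=1, sinθ=1, U_N²=2, U_min=U_max=U_N, γ=1: the state (q,λ_min,λ_max) alternates between (1,2,1) and (−1,1,2)). *)

theory Defs
  imports
    "HOL-Probability.Probability"
    "Jordan_Normal_Form.Gauss_Jordan_Elimination"
    "Jordan_Normal_Form.Spectral_Radius"
    "Graph_Theory.Digraph_Component"
begin

hide_const (open) Finite_Cartesian_Product.vec Finite_Cartesian_Product.mat
hide_type (open) Finite_Cartesian_Product.vec
no_notation vec_nth (infixl \<open>$\<close> 90)
no_notation inner (infix \<open>\<bullet>\<close> 70)

text \<open>
  Matrices and vectors are those of \<open>Jordan_Normal_Form\<close>, whose rows and columns are indexed from
  \<open>0\<close>. Accordingly the nodes of a graph with \<open>n\<close> nodes are \<open>0, \<dots>, n - 1\<close>, where \<open>0\<close> is the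
  distinguished node, \<open>1, \<dots>, m - 1\<close> are the microgenerators and \<open>m, \<dots>, n - 1\<close> the loads; the
  edges are \<open>0, \<dots>, card (arcs G) - 1\<close>. A vector indexed by the microgenerators has dimension
  \<open>m - 1\<close>, and its entry belonging to node \<open>h\<close> is entry \<open>h - 1\<close>.
\<close>

definition incidence_mat :: "(nat, nat) pre_digraph \<Rightarrow> real mat" where
  "incidence_mat G = mat (card (arcs G)) (card (verts G))
     (\<lambda>(e, v). if v = tail G e then -1 else if v = head G e then 1 else 0)"

text \<open>\<open>mat_inverse\<close> returns \<open>None\<close> exactly for singular matrices; only moduli of the impedances
  enter the Laplacian.\<close>

definition laplacian_mat :: "(nat, nat) pre_digraph \<Rightarrow> (nat \<Rightarrow> complex) \<Rightarrow> real mat" where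
  "laplacian_mat G z =
     transpose_mat (incidence_mat G)
       * the (mat_inverse (mat_diag (card (arcs G)) (\<lambda>e. cmod (z e))))
       * incidence_mat G"

definition ones_vec :: "nat \<Rightarrow> real vec" where
  "ones_vec k = vec k (\<lambda>_. 1)"

definition col_mat :: "real vec \<Rightarrow> real mat" where
  "col_mat v = mat (dim_vec v) 1 (\<lambda>(i, _). v $ i)"

definition sym_psd_mat :: "nat \<Rightarrow> real mat \<Rightarrow> bool" where
  "sym_psd_mat n X \<longleftrightarrow>
     X \<in> carrier_mat n n \<and> transpose_mat X = X \<and>
     (\<forall>x \<in> carrier_vec n. 0 \<le> x \<bullet> (X *\<^sub>v x))"

definition green_mat :: "(nat, nat) pre_digraph \<Rightarrow> (nat \<Rightarrow> complex) \<Rightarrow> real mat \<Rightarrow> bool" where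
  "green_mat G z X \<longleftrightarrow> (let n = card (verts G) in
     sym_psd_mat n X \<and>
     X * laplacian_mat G z =
       1\<^sub>m n - col_mat (ones_vec n) * transpose_mat (col_mat (unit_vec n 0)) \<and>
     X *\<^sub>v unit_vec n 0 = 0\<^sub>v n)"

definition pos_part :: "real \<Rightarrow> real" where
  "pos_part x = max 0 x"

end

theory Submission
  imports Defs
begin

text \<open>
  Put \<open>s = sin \<theta>\<close>. Once every microgenerator has been triggered, \<open>q\<^sub>G = s (\<lambda>\<^sub>m\<^sub>i\<^sub>n - \<lambda>\<^sub>m\<^sub>a\<^sub>x) - M\<^sup>-\<^sup>1 N q\<^sub>L\<close>,
  and the iteration is projected gradient ascent on the dual program in which each step updates the
  pair of multipliers of one node. The bound on \<open>\<gamma>\<close> makes the dual gap nonincreasing along every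
  trajectory (the diagonal entries of \<open>M\<close> are at most \<open>\<sigma>\<^sub>m\<^sub>a\<^sub>x\<close>), so the update steps tend to \<open>0\<close>.
  Almost surely the nodes are triggered infinitely often in the order \<open>1, \<dots>, m - 1\<close>. During such a
  sweep the state hardly moves, so the optimality residuals of all nodes are small at its start, and
  so is the dual gap. Being monotone, the gap tends to \<open>0\<close>, and it controls the distance to the
  optimum because \<open>M\<close> is positive definite.
\<close>

section \<open>Projected coordinate ascent\<close>

text \<open>The obstacle is the critical step size. The two multipliers of one node have curvature
  \<open>\<kappa>\<close> times the matrix with rows (1, -1) and (-1, 1), whose larger eigenvalue is
  \<open>2 * \<kappa>\<close>. The bound on \<open>\<gamma>\<close> only gives
  \<open>\<beta> * \<kappa> \<le> 1\<close>, which is the edge of stability of a gradient step: two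
  equal and opposite steps may then leave the dual gap unchanged. If the two bounds of the node also
  coincide, unclipped updates can reflect \<open>w\<close> in the common bound forever. This is what
  \<open>\<gamma>_bound_degenerate\<close> excludes, so that at each node either
  \<open>\<beta> * \<kappa> < 1\<close> or \<open>lo < hi\<close>. In the second case the slopes of
  the pair add up to \<open>hi - lo > 0\<close>, and steps that nearly cancel must involve clipping.
  Vanishing of the steps therefore rests on a decrease \<open>\<eta>(\<epsilon>)\<close> guaranteed
  for every step of size at least \<open>\<epsilon>\<close>, instead of a plain sum of squared
  steps.\<close>

lemma min_step_sq_le:
  fixes \<beta> l g :: real
  assumes "0 < \<beta>" "0 \<le> l"
  shows "(min l (\<beta> * g))\<^sup>2 \<le> \<beta> * g * min l (\<beta> * g)"
proof (cases "l \<le> \<beta> * g")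
  case True
  then show ?thesis using assms by (simp add: power2_eq_square mult_right_mono)
next
  case False
  then show ?thesis by (simp add: power2_eq_square)
qed

text \<open>As \<open>max 0 (l - \<beta> * g) = l - min l (\<beta> * g)\<close>, the numbers
  \<open>r\<close> and \<open>r'\<close> are the steps actually taken after projection. The
  right-hand side is \<open>\<beta>\<close> times the resulting decrease of the dual gap. Writing
  \<open>(r - r')\<^sup>2\<close> as \<open>2 * (r\<^sup>2 + r'\<^sup>2) - (r + r')\<^sup>2\<close>
  splits it into the margin in the step size, the failure of the steps to cancel, and the clipping
  losses.\<close>

lemma pair_decrease_split:
  fixes \<beta> \<kappa> l u g g' r r' :: real
  assumes \<beta>: "0 < \<beta>" and lu: "0 \<le> l" "0 \<le> u"
    and r: "r = min l (\<beta> * g)" and r': "r' = min u (\<beta> * g')"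
  shows "(1 - \<beta> * \<kappa>) * (r\<^sup>2 + r'\<^sup>2) + \<beta> * \<kappa> / 2 * (r + r')\<^sup>2
           + ((\<beta> * g - r) * r + (\<beta> * g' - r') * r')
         = \<beta> * (g * r + g' * r' - \<kappa> / 2 * (r - r')\<^sup>2)"
    and "0 \<le> (\<beta> * g - r) * r" "0 \<le> (\<beta> * g' - r') * r'"
proof -
  show "0 \<le> (\<beta> * g - r) * r" 
    using min_step_sq_le[OF \<beta> lu(1), of g] r by (simp add: algebra_simps power2_eq_square)
  show "0 \<le> (\<beta> * g' - r') * r'" 
    using min_step_sq_le[OF \<beta> lu(2), of g'] r' by (simp add: algebra_simps power2_eq_square)
qed (simp add: algebra_simps power2_eq_square)

lemma pair_decrease_nonneg:
  fixes \<beta> \<kappa> l u g g' :: real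
  assumes \<beta>: "0 < \<beta>" and \<kappa>: "0 \<le> \<kappa>" "\<beta> * \<kappa> \<le> 1" and lu: "0 \<le> l" "0 \<le> u"
  defines "r \<equiv> min l (\<beta> * g)" and "r' \<equiv> min u (\<beta> * g')"
  shows "0 \<le> g * r + g' * r' - \<kappa> / 2 * (r - r')\<^sup>2"
proof -
  note D = pair_decrease_split[OF \<beta> lu r_def[THEN meta_eq_to_obj_eq] r'_def[THEN meta_eq_to_obj_eq]]
  have "0 \<le> (1 - \<beta> * \<kappa>) * (r\<^sup>2 + r'\<^sup>2)" "0 \<le> \<beta> * \<kappa> / 2 * (r + r')\<^sup>2"
    using \<beta> \<kappa> by auto
  then have "0 \<le> \<beta> * (g * r + g' * r' - \<kappa> / 2 * (r - r')\<^sup>2)"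
    using D(1)[of \<kappa>] D(2,3) by linarith
  then show ?thesis using \<beta> by (simp add: zero_le_mult_iff)
qed

text \<open>The critical case of the step size bound: steps that almost cancel gain nothing from the
  quadratic term. As the slopes add up to a positive constant, one of the two steps is then clipped,
  and the clipping loss pays for the decrease.\<close>

lemma opposite_steps_gain:
  fixes r r' e e' d \<epsilon> :: real
  assumes "\<epsilon> \<le> \<bar>r\<bar>" "\<bar>r + r'\<bar> < \<epsilon> / 2" "\<bar>r + r'\<bar> < d / 2" "0 < \<epsilon>" "0 < d"
    and "r + e + r' + e' = d"
    and "0 \<le> e" "0 \<le> e'" "0 \<le> e * r" "0 \<le> e' * r'"
  shows "\<epsilon> / 2 * (d / 2) \<le> e * r + e' * r'"
proof (cases "0 \<le> r")
  case True
  then have "r \<ge> \<epsilon>" "r' < 0" using assms(1,2,4) by linarith+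
  then have "e' = 0" using assms(8,10) by (simp add: zero_le_mult_iff)
  then have "e \<ge> d / 2" using assms(3,6) by linarith
  moreover have "\<epsilon> / 2 \<le> r" using \<open>r \<ge> \<epsilon>\<close> assms(4) by linarith
  ultimately have "d / 2 * (\<epsilon> / 2) \<le> e * r" using assms(4,5) by (intro mult_mono) auto
  then show ?thesis using \<open>e' = 0\<close> by (simp add: mult.commute)
next
  case False
  then have "r < 0" "r' \<ge> \<epsilon> / 2" using assms(1,2,4) by linarith+
  then have "e = 0" using assms(7,9) by (simp add: zero_le_mult_iff)
  then have "e' \<ge> d / 2" using assms(3,6) by linarith
  then have "d / 2 * (\<epsilon> / 2) \<le> e' * r'" using assms(4,5) \<open>r' \<ge> \<epsilon> / 2\<close> by (intro mult_mono) auto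
  then show ?thesis using \<open>e = 0\<close> by (simp add: mult.commute)
qed

text \<open>The bound \<open>\<eta>\<close> does not depend on the state, so no bound on the
  individual multipliers is needed. Below the critical step size the first term of the split
  suffices; at it, either the steps do not cancel or the clipping loss is bounded below.\<close>

lemma pair_decrease_uniform:
  fixes \<beta> \<kappa> \<delta> \<epsilon> :: real
  assumes \<beta>: "0 < \<beta>" and \<kappa>: "0 \<le> \<kappa>" "\<beta> * \<kappa> \<le> 1" 
    and nondeg: "\<beta> * \<kappa> < 1 \<or> 0 < \<delta>" and \<epsilon>: "0 < \<epsilon>"
  shows "\<exists>\<eta>>0. \<forall>l u g g'. 0 \<le> l \<longrightarrow> 0 \<le> u \<longrightarrow> g + g' = \<delta> \<longrightarrow>
           \<epsilon> \<le> \<bar>min l (\<beta> * g)\<bar> \<or> \<epsilon> \<le> \<bar>min u (\<beta> * g')\<bar> \<longrightarrow>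
           \<eta> \<le> g * min l (\<beta> * g) + g' * min u (\<beta> * g') - \<kappa> / 2 * (min l (\<beta> * g) - min u (\<beta> * g'))\<^sup>2"
proof (cases "\<beta> * \<kappa> < 1")
  case True
  have "(1 - \<beta> * \<kappa>) * \<epsilon>\<^sup>2 / \<beta> \<le> g * r + g' * r' - \<kappa> / 2 * (r - r')\<^sup>2"
    if lu: "0 \<le> l" "0 \<le> u" and r: "r = min l (\<beta> * g)" "r' = min u (\<beta> * g')"
      and big: "\<epsilon> \<le> \<bar>r\<bar> \<or> \<epsilon> \<le> \<bar>r'\<bar>"
    for l u g g' r r' :: real
  proof -
    note D = pair_decrease_split[OF \<beta> lu r]
    have "\<epsilon>\<^sup>2 \<le> r\<^sup>2 \<or> \<epsilon>\<^sup>2 \<le> r'\<^sup>2" 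
      using big \<epsilon> by (metis abs_le_square_iff abs_of_pos)
    then have "\<epsilon>\<^sup>2 \<le> r\<^sup>2 + r'\<^sup>2" using zero_le_power2[of r] zero_le_power2[of r'] by linarith
    then have "(1 - \<beta> * \<kappa>) * \<epsilon>\<^sup>2 \<le> (1 - \<beta> * \<kappa>) * (r\<^sup>2 + r'\<^sup>2)"
      using True by (intro mult_left_mono) auto
    moreover have "0 \<le> \<beta> * \<kappa> / 2 * (r + r')\<^sup>2" using \<beta> \<kappa> by auto
    ultimately have "(1 - \<beta> * \<kappa>) * \<epsilon>\<^sup>2 \<le> \<beta> * (g * r + g' * r' - \<kappa> / 2 * (r - r')\<^sup>2)"
      using D(1)[of \<kappa>] D(2,3) by linarith
    then show ?thesis using \<beta> by (simp add: pos_divide_le_eq mult.commute)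
  qed
  moreover have "0 < (1 - \<beta> * \<kappa>) * \<epsilon>\<^sup>2 / \<beta>" using True \<beta> \<epsilon> by auto
  ultimately show ?thesis by blast
next
  case False
  then have eq1: "\<beta> * \<kappa> = 1" and \<delta>: "0 < \<delta>" using nondeg \<kappa> by auto
  define d where "d = \<beta> * \<delta>"
  have d: "0 < d" using \<beta> \<delta> by (simp add: d_def)
  \<comment> \<open>Steps with \<open>\<bar>r + r'\<bar> < a\<close> count as nearly cancelling;
    both halves are thresholds of \<open>opposite_steps_gain\<close>. Accordingly
    \<open>\<eta>\<close> is the smaller gain of the two cases, divided by \<open>\<beta>\<close>
    because the split is scaled by it.\<close>
  define a where "a = min (\<epsilon> / 2) (d / 2)"
  have a: "0 < a" using \<epsilon> d by (simp add: a_def)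
  define \<eta> where "\<eta> = min (a\<^sup>2 / 2) (\<epsilon> / 2 * (d / 2)) / \<beta>"
  have \<eta>: "0 < \<eta>" using a \<epsilon> d \<beta> by (simp add: \<eta>_def)
  have "\<eta> \<le> g * r + g' * r' - \<kappa> / 2 * (r - r')\<^sup>2"
    if lu: "0 \<le> l" "0 \<le> u" and r: "r = min l (\<beta> * g)" "r' = min u (\<beta> * g')"
      and sum: "g + g' = \<delta>" and big: "\<epsilon> \<le> \<bar>r\<bar> \<or> \<epsilon> \<le> \<bar>r'\<bar>"
    for l u g g' r r' :: real
  proof -
    note D = pair_decrease_split[OF \<beta> lu r]
    define e e' where "e = \<beta> * g - r" and "e' = \<beta> * g' - r'"
    have e: "0 \<le> e" "0 \<le> e'" by (auto simp: e_def e'_def r)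
    have er: "0 \<le> e * r" "0 \<le> e' * r'" using D(2,3) by (auto simp: e_def e'_def)
    have tot: "r + e + r' + e' = d" using sum by (auto simp: e_def e'_def d_def algebra_simps)
    have "min (a\<^sup>2 / 2) (\<epsilon> / 2 * (d / 2)) \<le> (r + r')\<^sup>2 / 2 + (e * r + e' * r')"
    proof (cases "\<bar>r + r'\<bar> < a")
      case True
      have "\<epsilon> / 2 * (d / 2) \<le> e * r + e' * r'"
      proof (cases "\<epsilon> \<le> \<bar>r\<bar>")
        case t: True
        show ?thesis by (rule opposite_steps_gain) (use t True \<epsilon> d tot e er in \<open>auto simp: a_def\<close>)
      next
        case False
        have "\<epsilon> / 2 * (d / 2) \<le> e' * r' + e * r"
          by (rule opposite_steps_gain) (use big False True \<epsilon> d tot e er in \<open>auto simp: a_def add.commute\<close>)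
        then show ?thesis by simp
      qed
      then show ?thesis using zero_le_power2[of "r + r'"] by linarith
    next
      case False
      then have "a\<^sup>2 \<le> (r + r')\<^sup>2" using a by (metis abs_le_square_iff abs_of_pos not_less)
      then show ?thesis using er by linarith
    qed
    also have "\<dots> = \<beta> * (g * r + g' * r' - \<kappa> / 2 * (r - r')\<^sup>2)"
      using D(1)[of \<kappa>] unfolding eq1 e_def e'_def by simp
    finally show ?thesis using \<beta> by (simp add: \<eta>_def pos_divide_le_eq mult.commute)
  qed
  then show ?thesis using \<eta> by blast
qed

section \<open>Expansion of quadratic forms and perturbation of residuals\<close>

definition quad_form :: "nat \<Rightarrow> (nat \<Rightarrow> nat \<Rightarrow> real) \<Rightarrow> (nat \<Rightarrow> real) \<Rightarrow> real" where
  "quad_form K A x = (\<Sum>i<K. x i * (\<Sum>j<K. A i j * x j))"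

lemma quad_form_decrease_coord:
  assumes sym: "\<And>i j. i < K \<Longrightarrow> j < K \<Longrightarrow> A i j = A j i" and k: "k < K"
  shows "quad_form K A (\<lambda>i. x i - (if i = k then d else 0))
           = quad_form K A x - 2 * d * (\<Sum>j<K. A k j * x j) + A k k * d\<^sup>2"
proof -
  define Ax where "Ax i = (\<Sum>j<K. A i j * x j)" for i
  have "(\<Sum>j<K. A i j * (x j - (if j = k then d else 0))) = Ax i - A i k * d" for i
    using k by (simp add: right_diff_distrib sum_subtractf Ax_def sum.delta if_distrib[of "\<lambda>y. _ * y"] cong: if_cong)
  then have "quad_form K A (\<lambda>i. x i - (if i = k then d else 0))
      = (\<Sum>i<K. (x i - (if i = k then d else 0)) * (Ax i - A i k * d))"
    by (simp add: quad_form_def)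
  also have "\<dots> = (\<Sum>i<K. x i * Ax i) - d * (\<Sum>i<K. A i k * x i)
                  - (\<Sum>i<K. if i = k then d * (Ax i - A i k * d) else 0)"
    unfolding sum_distrib_left sum_subtractf[symmetric] by (intro sum.cong) (auto simp: algebra_simps)
  also have "(\<Sum>i<K. A i k * x i) = Ax k"
    unfolding Ax_def using sym k by (intro sum.cong) auto
  also have "(\<Sum>i<K. if i = k then d * (Ax i - A i k * d) else 0) = d * (Ax k - A k k * d)"
    using k by simp
  finally show ?thesis
    by (simp add: quad_form_def Ax_def algebra_simps power2_eq_square)
qed

text \<open>Continuity of the minimum; it carries the residual of a coordinate from its update time
  back to the start of the sweep.\<close>

lemma min_add_error: "\<bar>min a b\<bar> \<le> \<bar>min c d\<bar> + \<bar>a - c\<bar> + \<bar>b - d\<bar>" for a b c d :: real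
  by linarith

text \<open>A small residual makes the multiplier or the slope small: either
  \<open>y \<le> l \<le> \<rho>\<close>, or \<open>g \<le> \<rho> / \<beta>\<close>. The right-hand
  side covers both cases. In the application \<open>y\<close> is the positive part of
  \<open>l - u\<close> or of \<open>u - l\<close>.\<close>

lemma complementarity_bound:
  fixes l g \<beta> \<rho> :: real
  assumes "0 < \<beta>" "0 \<le> y" "y \<le> l" "0 \<le> \<rho>" "\<bar>min l (\<beta> * g)\<bar> \<le> \<rho>"
  shows "y * g \<le> \<rho> * (\<bar>g\<bar> + y / \<beta>)"
proof (cases "l \<le> \<rho>")
  case True
  have "y * g \<le> y * \<bar>g\<bar>" using assms by (intro mult_left_mono) auto
  also have "\<dots> \<le> \<rho> * \<bar>g\<bar>" using assms True by (intro mult_right_mono) auto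
  also have "\<dots> \<le> \<rho> * (\<bar>g\<bar> + y / \<beta>)" using assms by (intro mult_left_mono) auto
  finally show ?thesis .
next
  case False
  then have "\<beta> * g \<le> \<rho>" using assms by linarith
  then have "g \<le> \<rho> / \<beta>" using assms by (simp add: field_simps)
  then have "y * g \<le> y * (\<rho> / \<beta>)" using assms by (intro mult_left_mono) auto
  also have "\<dots> \<le> \<rho> * (\<bar>g\<bar> + y / \<beta>)" using assms by (simp add: algebra_simps)
  finally show ?thesis .
qed

lemma null_of_min_null:
  fixes x y :: "nat \<Rightarrow> real"
  assumes "(\<lambda>n. min (x n) (y n)) \<longlonglongrightarrow> 0" "y \<longlonglongrightarrow> c" "0 < c"
  shows "x \<longlonglongrightarrow> 0"
proof (rule Lim_transform_eventually[OF assms(1)])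
  have "\<forall>\<^sub>F n in sequentially. min (x n) (y n) < c / 2" "\<forall>\<^sub>F n in sequentially. c / 2 < y n"
    using order_tendstoD(2)[OF assms(1), of "c / 2"] order_tendstoD(1)[OF assms(2), of "c / 2"] assms(3)
    by simp_all
  then show "\<forall>\<^sub>F n in sequentially. min (x n) (y n) = x n"
    by eventually_elim auto
qed

text \<open>\<open>l\<close> and \<open>u\<close> are the multipliers of the lower and the upper bounds on \<open>w = s M q\<close>, and \<open>A\<close> is
  \<open>s\<^sup>2 M\<close>. At the optimum \<open>w\<close> is \<open>wst\<close> and the multiplier difference is \<open>mst\<close>; the multipliers themselves
  are not unique if \<open>lo = hi\<close>.\<close>

locale dual_coordinate_ascent =
  fixes K :: nat and A :: "nat \<Rightarrow> nat \<Rightarrow> real" and \<beta> C :: real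
    and lo hi wst mst :: "nat \<Rightarrow> real"
    and k :: "nat \<Rightarrow> nat" and l u :: "nat \<Rightarrow> nat \<Rightarrow> real"
  assumes sym: "i < K \<Longrightarrow> j < K \<Longrightarrow> A i j = A j i"
    and C_pos: "0 < C"
    and coercive: "i < K \<Longrightarrow> (x i)\<^sup>2 \<le> C * quad_form K A x"
    and \<beta>_pos: "0 < \<beta>"
    and diag: "i < K \<Longrightarrow> 0 \<le> A i i" "i < K \<Longrightarrow> \<beta> * A i i \<le> 1"
    and nondegenerate: "i < K \<Longrightarrow> \<beta> * A i i < 1 \<or> lo i < hi i"
    and box: "i < K \<Longrightarrow> lo i \<le> wst i" "i < K \<Longrightarrow> wst i \<le> hi i"
    and complementary: "i < K \<Longrightarrow> 0 < mst i \<Longrightarrow> wst i = lo i"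
      "i < K \<Longrightarrow> mst i < 0 \<Longrightarrow> wst i = hi i"
    and select: "k t < K"
    and l_nonneg: "i < K \<Longrightarrow> 0 \<le> l t i" and u_nonneg: "i < K \<Longrightarrow> 0 \<le> u t i"
    and l_step: "i < K \<Longrightarrow> l (Suc t) i = (if i = k t then
        max 0 (l t i + \<beta> * (lo i - (wst i + (\<Sum>j<K. A i j * (l t j - u t j - mst j))))) else l t i)"
    and u_step: "i < K \<Longrightarrow> u (Suc t) i = (if i = k t then
        max 0 (u t i + \<beta> * ((wst i + (\<Sum>j<K. A i j * (l t j - u t j - mst j))) - hi i)) else u t i)"
    and sweeps: "\<exists>\<^sub>\<infinity>t. \<forall>i<K. k (t + i) = i"
begin

definition err :: "nat \<Rightarrow> nat \<Rightarrow> real" where "err t i = l t i - u t i - mst i"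
definition w :: "nat \<Rightarrow> nat \<Rightarrow> real" where "w t i = wst i + (\<Sum>j<K. A i j * err t j)"
text \<open>The step node \<open>i\<close> would take if it were triggered now. It vanishes exactly
  when multiplier and slack are nonnegative and one of them is zero, so it measures the violation of
  the complementarity conditions.\<close>

definition res_l :: "nat \<Rightarrow> nat \<Rightarrow> real" where "res_l t i = min (l t i) (\<beta> * (w t i - lo i))"
definition res_u :: "nat \<Rightarrow> nat \<Rightarrow> real" where "res_u t i = min (u t i) (\<beta> * (hi i - w t i))"
text \<open>The dual suboptimality gap, expanded around the optimum. Its partial derivatives with respect
  to \<open>l\<close> and \<open>u\<close> are \<open>w - lo\<close> and \<open>hi - w\<close>.\<close>

definition V :: "nat \<Rightarrow> real" where
  "V t = quad_form K A (err t) / 2 + (\<Sum>i<K. l t i * (wst i - lo i)) + (\<Sum>i<K. u t i * (hi i - wst i))"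

section \<open>Monotonicity of the dual gap and vanishing of the steps\<close>

lemma l_Suc: "i < K \<Longrightarrow> l (Suc t) i = l t i - (if i = k t then res_l t i else 0)"
  by (simp add: l_step res_l_def w_def err_def algebra_simps max_def min_def)

lemma u_Suc: "i < K \<Longrightarrow> u (Suc t) i = u t i - (if i = k t then res_u t i else 0)"
  by (simp add: u_step res_u_def w_def err_def algebra_simps max_def min_def)

lemma quad_form_nonneg: "0 \<le> quad_form K A x"
proof -
  have "0 < K" using select[of 0] by simp
  then have "0 \<le> C * quad_form K A x" by (rule order_trans[OF zero_le_power2 coercive])
  then show ?thesis using C_pos by (simp add: zero_le_mult_iff)
qed

lemma quad_form_le_V: "quad_form K A (err t) \<le> 2 * V t" 
proof -
  have "0 \<le> (\<Sum>i<K. l t i * (wst i - lo i))" "0 \<le> (\<Sum>i<K. u t i * (hi i - wst i))"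
    using box l_nonneg u_nonneg by (auto intro!: sum_nonneg mult_nonneg_nonneg)
  then show ?thesis by (simp add: V_def)
qed

lemma V_nonneg: "0 \<le> V t"
  using quad_form_le_V[of t] quad_form_nonneg[of "err t"] by linarith

text \<open>\<open>V\<close> is quadratic, so its second-order expansion is exact;
  \<open>err\<close> moves by the difference of the two steps. The slope \<open>w - wst\<close> of
  the quadratic part and the weights \<open>wst - lo\<close>, \<open>hi - wst\<close> of the linear
  part add up to the true slopes.\<close>

lemma V_Suc:
  "V t - V (Suc t) = (w t (k t) - lo (k t)) * res_l t (k t) + (hi (k t) - w t (k t)) * res_u t (k t)
     - A (k t) (k t) / 2 * (res_l t (k t) - res_u t (k t))\<^sup>2"
proof -
  define i where "i = k t"
  have i: "i < K" using select by (simp add: i_def)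
  define d where "d = res_l t i - res_u t i"
  have "quad_form K A (err (Suc t)) = quad_form K A (\<lambda>j. err t j - (if j = i then d else 0))"
    unfolding quad_form_def
    by (intro sum.cong arg_cong2[where f="(*)"])
       (auto simp: err_def l_Suc u_Suc d_def i_def intro!: sum.cong)
  also have "\<dots> = quad_form K A (err t) - 2 * d * (w t i - wst i) + A i i * d\<^sup>2"
    using quad_form_decrease_coord[where A=A and K=K and k=i and x="err t" and d=d, OF sym i] by (simp add: w_def)
  finally have q: "quad_form K A (err (Suc t)) = \<dots>" .
  have "(\<Sum>j<K. l (Suc t) j * (wst j - lo j)) = 
      (\<Sum>j<K. l t j * (wst j - lo j) - (if j = i then res_l t j * (wst j - lo j) else 0))"
    by (intro sum.cong) (auto simp: l_Suc i_def algebra_simps)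
  then have ll: "(\<Sum>j<K. l (Suc t) j * (wst j - lo j)) = 
      (\<Sum>j<K. l t j * (wst j - lo j)) - res_l t i * (wst i - lo i)"
    using i by (simp add: sum_subtractf)
  have "(\<Sum>j<K. u (Suc t) j * (hi j - wst j)) = 
      (\<Sum>j<K. u t j * (hi j - wst j) - (if j = i then res_u t j * (hi j - wst j) else 0))"
    by (intro sum.cong) (auto simp: u_Suc i_def algebra_simps)
  then have uu: "(\<Sum>j<K. u (Suc t) j * (hi j - wst j)) = 
      (\<Sum>j<K. u t j * (hi j - wst j)) - res_u t i * (hi i - wst i)"
    using i by (simp add: sum_subtractf)
  show ?thesis
    unfolding V_def q ll uu i_def[symmetric] d_def by (simp add: field_simps)
qed

lemma V_Suc_le: "V (Suc t) \<le> V t"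
proof -
  have "0 \<le> V t - V (Suc t)"
    unfolding V_Suc res_l_def res_u_def
    by (intro pair_decrease_nonneg \<beta>_pos diag l_nonneg u_nonneg select)
  then show ?thesis by simp
qed

lemma V_decseq: "decseq V"
  using V_Suc_le by (rule decseq_SucI)

lemma V_decrease_tendsto: "(\<lambda>t. V t - V (Suc t)) \<longlonglongrightarrow> 0"
proof -
  have "convergent V" 
    using V_decseq V_nonneg decseq_convergent[of V 0] by (metis convergentI)
  then obtain L where "V \<longlonglongrightarrow> L" by (auto simp: convergent_def)
  then have "(\<lambda>t. V t - V (Suc t)) \<longlonglongrightarrow> L - L" by (intro tendsto_diff LIMSEQ_Suc)
  then show ?thesis by simp
qed

text \<open>A triggered residual of size at least \<open>\<epsilon>\<close> would lower
  \<open>V\<close> by at least \<open>\<eta> i\<close>, and the decreases of \<open>V\<close>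
  eventually fall below these finitely many numbers.\<close>

lemma residual_eventually_small:
  assumes "0 < \<epsilon>"
  shows "\<forall>\<^sub>F t in sequentially. \<bar>res_l t (k t)\<bar> < \<epsilon> \<and> \<bar>res_u t (k t)\<bar> < \<epsilon>"
proof -
  have "\<exists>\<eta>>0. \<forall>l u g g'. 0 \<le> l \<longrightarrow> 0 \<le> u \<longrightarrow> g + g' = hi i - lo i \<longrightarrow>
           \<epsilon> \<le> \<bar>min l (\<beta> * g)\<bar> \<or> \<epsilon> \<le> \<bar>min u (\<beta> * g')\<bar> \<longrightarrow>
           \<eta> \<le> g * min l (\<beta> * g) + g' * min u (\<beta> * g')
              - A i i / 2 * (min l (\<beta> * g) - min u (\<beta> * g'))\<^sup>2" if "i < K" for i
    using nondegenerate[OF that] that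
    by (intro pair_decrease_uniform \<beta>_pos diag assms) auto
  then obtain \<eta> where \<eta>: "\<And>i. i < K \<Longrightarrow> 0 < \<eta> i" 
    and dec: "\<And>i l u g g'. i < K \<Longrightarrow> 0 \<le> l \<Longrightarrow> 0 \<le> u \<Longrightarrow> g + g' = hi i - lo i \<Longrightarrow>
           \<epsilon> \<le> \<bar>min l (\<beta> * g)\<bar> \<or> \<epsilon> \<le> \<bar>min u (\<beta> * g')\<bar> \<Longrightarrow>
           \<eta> i \<le> g * min l (\<beta> * g) + g' * min u (\<beta> * g')
              - A i i / 2 * (min l (\<beta> * g) - min u (\<beta> * g'))\<^sup>2"
    by metis
  have "\<forall>\<^sub>F t in sequentially. \<forall>i\<in>{..<K}. V t - V (Suc t) < \<eta> i"
    using \<eta> order_tendstoD(2)[OF V_decrease_tendsto]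
    by (intro eventually_ball_finite) auto
  then show ?thesis
  proof eventually_elim
    case (elim t)
    have "V t - V (Suc t) < \<eta> (k t)" using elim select by auto
    moreover have "\<eta> (k t) \<le> V t - V (Suc t)" if "\<epsilon> \<le> \<bar>res_l t (k t)\<bar> \<or> \<epsilon> \<le> \<bar>res_u t (k t)\<bar>"
      using that unfolding V_Suc res_l_def res_u_def
      by (intro dec select l_nonneg u_nonneg) auto
    ultimately show ?case by force
  qed
qed

lemma triggered_residual_tendsto:
  "(\<lambda>t. res_l t (k t)) \<longlonglongrightarrow> 0" "(\<lambda>t. res_u t (k t)) \<longlonglongrightarrow> 0"
proof -
  show "(\<lambda>t. res_l t (k t)) \<longlonglongrightarrow> 0"
    unfolding tendsto_iff dist_real_def
    by (auto intro: eventually_mono[OF residual_eventually_small])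
  show "(\<lambda>t. res_u t (k t)) \<longlonglongrightarrow> 0"
    unfolding tendsto_iff dist_real_def
    by (auto intro: eventually_mono[OF residual_eventually_small])
qed

text \<open>With \<open>r\<close> fixed, the change is a sum of at most \<open>r\<close> triggered
  residuals, each of which tends to zero.\<close>

lemma shift_tendsto:
  assumes "i < K"
  shows "(\<lambda>t. l (t + r) i - l t i) \<longlonglongrightarrow> 0" "(\<lambda>t. u (t + r) i - u t i) \<longlonglongrightarrow> 0"
proof -
  have l: "(\<lambda>t. if i = k (t + r) then res_l (t + r) i else 0) \<longlonglongrightarrow> 0" for r
    by (rule Lim_null_comparison[OF _ LIMSEQ_ignore_initial_segment[OF tendsto_rabs_zero[OF triggered_residual_tendsto(1)], of r]])
       auto
  have u: "(\<lambda>t. if i = k (t + r) then res_u (t + r) i else 0) \<longlonglongrightarrow> 0" for r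
    by (rule Lim_null_comparison[OF _ LIMSEQ_ignore_initial_segment[OF tendsto_rabs_zero[OF triggered_residual_tendsto(2)], of r]])
       auto
  show "(\<lambda>t. l (t + r) i - l t i) \<longlonglongrightarrow> 0"
  proof (induction r)
    case (Suc r)
    show ?case using tendsto_diff[OF Suc l[of r]] assms by (simp add: l_Suc algebra_simps)
  qed simp
  show "(\<lambda>t. u (t + r) i - u t i) \<longlonglongrightarrow> 0"
  proof (induction r)
    case (Suc r)
    show ?case using tendsto_diff[OF Suc u[of r]] assms by (simp add: u_Suc algebra_simps)
  qed simp
qed

lemma shift_w_tendsto: "(\<lambda>t. w (t + r) i - w t i) \<longlonglongrightarrow> 0"
proof -
  have "(\<lambda>t. \<Sum>j<K. A i j * ((l (t + r) j - l t j) - (u (t + r) j - u t j))) \<longlonglongrightarrow> (\<Sum>j<K. A i j * (0 - 0))"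
    by (intro tendsto_intros shift_tendsto) auto
  moreover have "w (t + r) i - w t i = (\<Sum>j<K. A i j * ((l (t + r) j - l t j) - (u (t + r) j - u t j)))" for t
    by (simp add: w_def err_def sum_subtractf[symmetric] algebra_simps)
  ultimately show ?thesis by simp
qed

text \<open>Along the starts of full sweeps, all residuals vanish: coordinate \<open>i\<close> is updated \<open>i\<close> steps
  after the start, and until then the state has barely moved.\<close>

lemma sweep_residual_tendsto:
  assumes \<tau>: "strict_mono \<tau>" and sweep: "\<And>n i. i < K \<Longrightarrow> k (\<tau> n + i) = i" and i: "i < K"
  shows "(\<lambda>n. res_l (\<tau> n) i) \<longlonglongrightarrow> 0" "(\<lambda>n. res_u (\<tau> n) i) \<longlonglongrightarrow> 0"
proof -
  note sub = LIMSEQ_subseq_LIMSEQ[OF _ \<tau>, unfolded comp_def]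
  have e: "(\<lambda>n. \<bar>res_l (\<tau> n + i) i\<bar> + \<bar>l (\<tau> n + i) i - l (\<tau> n) i\<bar> + \<bar>\<beta> * (w (\<tau> n + i) i - w (\<tau> n) i)\<bar>)
      \<longlonglongrightarrow> \<bar>0\<bar> + \<bar>0\<bar> + \<bar>\<beta> * 0\<bar>"
    using sub[OF LIMSEQ_ignore_initial_segment[OF triggered_residual_tendsto(1), of i]] sweep i
    by (intro tendsto_intros sub[OF shift_tendsto(1)] sub[OF shift_w_tendsto] i) simp
  show "(\<lambda>n. res_l (\<tau> n) i) \<longlonglongrightarrow> 0"
  proof (rule Lim_null_comparison[OF always_eventually])
    show "\<forall>n. norm (res_l (\<tau> n) i) \<le> \<bar>res_l (\<tau> n + i) i\<bar> + \<bar>l (\<tau> n + i) i - l (\<tau> n) i\<bar> + \<bar>\<beta> * (w (\<tau> n + i) i - w (\<tau> n) i)\<bar>"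
    proof
      fix n
      show "norm (res_l (\<tau> n) i) \<le> \<bar>res_l (\<tau> n + i) i\<bar> + \<bar>l (\<tau> n + i) i - l (\<tau> n) i\<bar> + \<bar>\<beta> * (w (\<tau> n + i) i - w (\<tau> n) i)\<bar>"
        using min_add_error[of "l (\<tau> n) i" "\<beta> * (w (\<tau> n) i - lo i)" "l (\<tau> n + i) i" "\<beta> * (w (\<tau> n + i) i - lo i)"]
        by (simp add: res_l_def algebra_simps abs_minus_commute)
    qed
  qed (use e in simp)
  have e: "(\<lambda>n. \<bar>res_u (\<tau> n + i) i\<bar> + \<bar>u (\<tau> n + i) i - u (\<tau> n) i\<bar> + \<bar>\<beta> * (w (\<tau> n + i) i - w (\<tau> n) i)\<bar>)
      \<longlonglongrightarrow> \<bar>0\<bar> + \<bar>0\<bar> + \<bar>\<beta> * 0\<bar>"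
    using sub[OF LIMSEQ_ignore_initial_segment[OF triggered_residual_tendsto(2), of i]] sweep i
    by (intro tendsto_intros sub[OF shift_tendsto(2)] sub[OF shift_w_tendsto] i) simp
  show "(\<lambda>n. res_u (\<tau> n) i) \<longlonglongrightarrow> 0"
  proof (rule Lim_null_comparison[OF always_eventually])
    show "\<forall>n. norm (res_u (\<tau> n) i) \<le> \<bar>res_u (\<tau> n + i) i\<bar> + \<bar>u (\<tau> n + i) i - u (\<tau> n) i\<bar> + \<bar>\<beta> * (w (\<tau> n + i) i - w (\<tau> n) i)\<bar>"
    proof
      fix n
      show "norm (res_u (\<tau> n) i) \<le> \<bar>res_u (\<tau> n + i) i\<bar> + \<bar>u (\<tau> n + i) i - u (\<tau> n) i\<bar> + \<bar>\<beta> * (w (\<tau> n + i) i - w (\<tau> n) i)\<bar>"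
        using min_add_error[of "u (\<tau> n) i" "\<beta> * (hi i - w (\<tau> n) i)" "u (\<tau> n + i) i" "\<beta> * (hi i - w (\<tau> n + i) i)"]
        by (simp add: res_u_def algebra_simps abs_minus_commute)
    qed
  qed (use e in simp)
qed

text \<open>Summed over \<open>i\<close>, the left-hand side is the quadratic form of
  \<open>err\<close>. It is split along \<open>err = (l - u) - mst\<close>. For \<open>l - u\<close>
  the residual gives approximate complementarity, after \<open>wst\<close> has been replaced by the
  bound on the relevant side. For \<open>mst\<close> complementarity is exact, so only the
  infeasibility of \<open>w\<close> remains.\<close>

lemma gap_le_residual:
  assumes i: "i < K"
  shows "err t i * (w t i - wst i) \<le> (\<bar>res_l t i\<bar> + \<bar>res_u t i\<bar>) *
           (\<bar>w t i - lo i\<bar> + \<bar>hi i - w t i\<bar> + (\<bar>l t i - u t i\<bar> + \<bar>mst i\<bar>) / \<beta>)"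
proof -
  define \<rho> \<mu> g g' where "\<rho> = \<bar>res_l t i\<bar> + \<bar>res_u t i\<bar>" and "\<mu> = l t i - u t i"
    and "g = w t i - lo i" and "g' = hi i - w t i"
  have \<rho>: "0 \<le> \<rho>" "\<bar>min (l t i) (\<beta> * g)\<bar> \<le> \<rho>" "\<bar>min (u t i) (\<beta> * g')\<bar> \<le> \<rho>"
    by (auto simp: \<rho>_def g_def g'_def res_l_def res_u_def)
  have lu: "0 \<le> l t i" "0 \<le> u t i" using i l_nonneg u_nonneg by auto
  have \<mu>: "\<mu> * (w t i - wst i) \<le> \<rho> * (\<bar>g\<bar> + \<bar>g'\<bar> + \<bar>\<mu>\<bar> / \<beta>)"
  proof (cases "0 \<le> \<mu>")
    case True
    have "\<mu> * (w t i - wst i) \<le> \<mu> * g"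
      using True box(1)[OF i] by (intro mult_left_mono) (auto simp: g_def)
    also have "\<dots> \<le> \<rho> * (\<bar>g\<bar> + \<mu> / \<beta>)"
      by (rule complementarity_bound[OF \<beta>_pos True _ \<rho>(1,2)]) (use lu in \<open>simp add: \<mu>_def\<close>)
    also have "\<dots> \<le> \<rho> * (\<bar>g\<bar> + \<bar>g'\<bar> + \<bar>\<mu>\<bar> / \<beta>)"
      using True \<rho> by (intro mult_left_mono) auto
    finally show ?thesis .
  next
    case False
    have "\<mu> * (w t i - wst i) = (- \<mu>) * (wst i - w t i)" by (simp add: algebra_simps)
    also have "\<dots> \<le> (- \<mu>) * g'"
      using False box(2)[OF i] by (intro mult_left_mono) (auto simp: g'_def)
    also have "\<dots> \<le> \<rho> * (\<bar>g'\<bar> + (- \<mu>) / \<beta>)"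
      by (rule complementarity_bound[OF \<beta>_pos _ _ \<rho>(1,3)]) (use lu False in \<open>auto simp: \<mu>_def\<close>)
    also have "\<dots> \<le> \<rho> * (\<bar>g\<bar> + \<bar>g'\<bar> + \<bar>\<mu>\<bar> / \<beta>)"
      using False \<rho> by (intro mult_left_mono) auto
    finally show ?thesis .
  qed
  \<comment> \<open>The minimum lies below the scaled slope, so the residual also bounds how far
    \<open>w\<close> leaves the box.\<close>
  have "- g \<le> \<rho> / \<beta>" "- g' \<le> \<rho> / \<beta>"
    using \<rho> \<beta>_pos by (auto simp: field_simps min_def abs_le_iff split: if_splits)
  have "- mst i * (w t i - wst i) \<le> \<bar>mst i\<bar> * (\<rho> / \<beta>)"
  proof (cases "mst i" "0 :: real" rule: linorder_cases)
    case less
    then have "- mst i * (w t i - wst i) = \<bar>mst i\<bar> * (- g')"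
      using complementary(2)[OF i] by (simp add: g'_def algebra_simps)
    also have "\<dots> \<le> \<bar>mst i\<bar> * (\<rho> / \<beta>)" using \<open>- g' \<le> \<rho> / \<beta>\<close> by (intro mult_left_mono) auto
    finally show ?thesis .
  next
    case greater
    then have "- mst i * (w t i - wst i) = \<bar>mst i\<bar> * (- g)"
      using complementary(1)[OF i] by (simp add: g_def algebra_simps)
    also have "\<dots> \<le> \<bar>mst i\<bar> * (\<rho> / \<beta>)" using \<open>- g \<le> \<rho> / \<beta>\<close> by (intro mult_left_mono) auto
    finally show ?thesis .
  qed simp
  then show ?thesis
    using \<mu> unfolding err_def \<rho>_def[symmetric] \<mu>_def[symmetric] g_def[symmetric] g'_def[symmetric]
    by (simp add: algebra_simps add_divide_distrib)
qed

lemma err_square_le: "i < K \<Longrightarrow> (err t i)\<^sup>2 \<le> C * (2 * V t)"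
  by (rule order_trans[OF coercive mult_left_mono[OF quad_form_le_V less_imp_le[OF C_pos]]])

text \<open>Coercivity and the monotonicity of \<open>V\<close> bound \<open>err\<close>. The factor
  contains the multipliers only through \<open>l - u\<close>, which \<open>err\<close>
  controls.\<close>

lemma gap_factor_bounded:
  assumes i: "i < K"
  shows "\<exists>D. \<forall>t. \<bar>w t i - lo i\<bar> + \<bar>hi i - w t i\<bar> + (\<bar>l t i - u t i\<bar> + \<bar>mst i\<bar>) / \<beta> \<le> D"
proof -
  define R where "R = sqrt (C * (2 * V 0))"
  have e: "\<bar>err t j\<bar> \<le> R" if "j < K" for t j
  proof -
    have "V t \<le> V 0" using V_decseq by (simp add: decseq_def)
    then have "C * (2 * V t) \<le> C * (2 * V 0)" using C_pos by simp
    then have "(err t j)\<^sup>2 \<le> C * (2 * V 0)" using err_square_le[OF that, of t] by linarith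
    then show ?thesis unfolding R_def by (rule real_le_rsqrt[of "\<bar>_\<bar>", simplified])
  qed
  have w: "\<bar>w t i - wst i\<bar> \<le> (\<Sum>j<K. \<bar>A i j\<bar> * R)" for t
  proof -
    have "\<bar>w t i - wst i\<bar> \<le> (\<Sum>j<K. \<bar>A i j * err t j\<bar>)"
      by (simp add: w_def sum_abs)
    also have "\<dots> \<le> (\<Sum>j<K. \<bar>A i j\<bar> * R)"
      by (intro sum_mono) (auto simp: abs_mult intro: mult_left_mono e)
    finally show ?thesis .
  qed
  have "\<bar>w t i - lo i\<bar> + \<bar>hi i - w t i\<bar> + (\<bar>l t i - u t i\<bar> + \<bar>mst i\<bar>) / \<beta>
      \<le> 2 * (\<Sum>j<K. \<bar>A i j\<bar> * R) + \<bar>wst i - lo i\<bar> + \<bar>hi i - wst i\<bar> + (R + 2 * \<bar>mst i\<bar>) / \<beta>" for t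
  proof -
    have "\<bar>l t i - u t i\<bar> + \<bar>mst i\<bar> \<le> R + 2 * \<bar>mst i\<bar>" using e[OF i, of t] by (simp add: err_def)
    then have "(\<bar>l t i - u t i\<bar> + \<bar>mst i\<bar>) / \<beta> \<le> (R + 2 * \<bar>mst i\<bar>) / \<beta>"
      using \<beta>_pos by (intro divide_right_mono) auto
    then show ?thesis using w[of t] by linarith
  qed
  then show ?thesis by blast
qed

lemma err_tendsto_of_quad_form:
  assumes "(\<lambda>n. quad_form K A (err (\<tau> n))) \<longlonglongrightarrow> 0" and i: "i < K"
  shows "(\<lambda>n. err (\<tau> n) i) \<longlonglongrightarrow> 0"
proof -
  have "(\<lambda>n. (err (\<tau> n) i)\<^sup>2) \<longlonglongrightarrow> 0"
    by (rule Lim_null_comparison[where g="\<lambda>n. C * quad_form K A (err (\<tau> n))"])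
       (use coercive[OF i] tendsto_mult_right_zero[OF assms(1)] in auto)
  then show ?thesis by simp
qed

lemma V_tendsto: "V \<longlonglongrightarrow> 0"
proof -
  obtain \<tau> :: "nat \<Rightarrow> nat" where \<tau>: "strict_mono \<tau>" and sweep: "\<And>n i. i < K \<Longrightarrow> k (\<tau> n + i) = i"
    using infinite_enumerate[of "{t. \<forall>i<K. k (t + i) = i}"] sweeps
    by (auto simp: frequently_cofinite)
  have res: "(\<lambda>n. res_l (\<tau> n) i) \<longlonglongrightarrow> 0" "(\<lambda>n. res_u (\<tau> n) i) \<longlonglongrightarrow> 0" if "i < K" for i
    using sweep_residual_tendsto[OF \<tau> _ that] sweep by auto
  obtain D where D: "\<And>i t. i < K \<Longrightarrow>
      \<bar>w t i - lo i\<bar> + \<bar>hi i - w t i\<bar> + (\<bar>l t i - u t i\<bar> + \<bar>mst i\<bar>) / \<beta> \<le> D i"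
    using gap_factor_bounded by metis
  have Q: "(\<lambda>n. quad_form K A (err (\<tau> n))) \<longlonglongrightarrow> 0"
  proof (rule Lim_null_comparison[OF always_eventually])
    show "\<forall>n. norm (quad_form K A (err (\<tau> n))) \<le>
            (\<Sum>i<K. (\<bar>res_l (\<tau> n) i\<bar> + \<bar>res_u (\<tau> n) i\<bar>) * D i)"
    proof
      fix n
      have "quad_form K A (err (\<tau> n)) = (\<Sum>i<K. err (\<tau> n) i * (w (\<tau> n) i - wst i))"
        by (simp add: quad_form_def w_def)
      also have "\<dots> \<le> (\<Sum>i<K. (\<bar>res_l (\<tau> n) i\<bar> + \<bar>res_u (\<tau> n) i\<bar>) * D i)"
        by (intro sum_mono order_trans[OF gap_le_residual] mult_left_mono D) auto
      finally show "norm (quad_form K A (err (\<tau> n))) \<le> \<dots>"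
        using quad_form_nonneg by simp
    qed
    have "(\<lambda>n. \<Sum>i<K. (\<bar>res_l (\<tau> n) i\<bar> + \<bar>res_u (\<tau> n) i\<bar>) * D i) \<longlonglongrightarrow> (\<Sum>i<K. (\<bar>0\<bar> + \<bar>0\<bar>) * D i)"
      by (intro tendsto_intros res) auto
    then show "(\<lambda>n. \<Sum>i<K. (\<bar>res_l (\<tau> n) i\<bar> + \<bar>res_u (\<tau> n) i\<bar>) * D i) \<longlonglongrightarrow> 0" by simp
  qed
  have w: "(\<lambda>n. w (\<tau> n) i) \<longlonglongrightarrow> wst i" for i
  proof -
    have "(\<lambda>n. w (\<tau> n) i) \<longlonglongrightarrow> wst i + (\<Sum>j<K. A i j * 0)"
      unfolding w_def by (intro tendsto_intros err_tendsto_of_quad_form[OF Q]) auto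
    then show ?thesis by simp
  qed
  \<comment> \<open>The quadratic part does not control the linear terms of \<open>V\<close>. At an
    active bound the weight is zero, whatever the multiplier does. At an inactive one the slope
    stays positive, so a vanishing residual forces the multiplier to zero.\<close>
  have l: "(\<lambda>n. l (\<tau> n) i * (wst i - lo i)) \<longlonglongrightarrow> 0" if i: "i < K" for i
  proof (cases "wst i = lo i")
    case False
    have "(\<lambda>n. l (\<tau> n) i) \<longlonglongrightarrow> 0"
    proof (rule null_of_min_null)
      show "(\<lambda>n. min (l (\<tau> n) i) (\<beta> * (w (\<tau> n) i - lo i))) \<longlonglongrightarrow> 0"
        using res(1)[OF i] by (simp add: res_l_def)
      show "(\<lambda>n. \<beta> * (w (\<tau> n) i - lo i)) \<longlonglongrightarrow> \<beta> * (wst i - lo i)" by (intro tendsto_intros w)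
      show "0 < \<beta> * (wst i - lo i)" using False box(1)[OF i] \<beta>_pos by simp
    qed
    then show ?thesis by (rule tendsto_mult_left_zero)
  qed simp
  have u: "(\<lambda>n. u (\<tau> n) i * (hi i - wst i)) \<longlonglongrightarrow> 0" if i: "i < K" for i
  proof (cases "wst i = hi i")
    case False
    have "(\<lambda>n. u (\<tau> n) i) \<longlonglongrightarrow> 0"
    proof (rule null_of_min_null)
      show "(\<lambda>n. min (u (\<tau> n) i) (\<beta> * (hi i - w (\<tau> n) i))) \<longlonglongrightarrow> 0"
        using res(2)[OF i] by (simp add: res_u_def)
      show "(\<lambda>n. \<beta> * (hi i - w (\<tau> n) i)) \<longlonglongrightarrow> \<beta> * (hi i - wst i)" by (intro tendsto_intros w)
      show "0 < \<beta> * (hi i - wst i)" using False box(2)[OF i] \<beta>_pos by simp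
    qed
    then show ?thesis by (rule tendsto_mult_left_zero)
  qed simp
  have "(\<lambda>n. V (\<tau> n)) \<longlonglongrightarrow> 0 / 2 + (\<Sum>i<K. 0) + (\<Sum>i<K. 0)"
    unfolding V_def by (intro tendsto_intros Q l u) auto
  then have sub: "(V \<circ> \<tau>) \<longlonglongrightarrow> 0" by (simp add: comp_def)
  obtain L where L: "V \<longlonglongrightarrow> L"
    using decseq_convergent[OF V_decseq] V_nonneg by metis
  have "L = 0" using LIMSEQ_unique[OF LIMSEQ_subseq_LIMSEQ[OF L \<tau>] sub] .
  then show ?thesis using L by simp
qed

theorem multiplier_difference_tendsto:
  assumes i: "i < K"
  shows "(\<lambda>t. l t i - u t i) \<longlonglongrightarrow> mst i"
proof -
  have "(\<lambda>t. quad_form K A (err t)) \<longlonglongrightarrow> 0"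
    by (rule Lim_null_comparison[where g="\<lambda>t. 2 * V t"])
       (use quad_form_le_V quad_form_nonneg tendsto_mult_right_zero[OF V_tendsto] in auto)
  then have "(\<lambda>t. err t i) \<longlonglongrightarrow> 0" using err_tendsto_of_quad_form[of "\<lambda>t. t"] i by simp
  from tendsto_add[OF this tendsto_const[of "mst i"]] show ?thesis by (simp add: err_def)
qed

end
text \<open>The initial state is arbitrary: multipliers may be negative and \<open>q\<close> need
  not match them. The locale is therefore applied to the trajectory shifted by \<open>T\<close>,
  when every node has been updated once. Assumption \<open>opt\<close> is the variational inequality
  of the box in single coordinates; testing it with \<open>v = lo i\<close> and
  \<open>v = hi i\<close> gives the complementarity of \<open>mst\<close>.\<close>

lemma coordinate_ascent_pathwise:
  fixes M :: "nat \<Rightarrow> nat \<Rightarrow> real" and q l u :: "nat \<Rightarrow> nat \<Rightarrow> real"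
  assumes sym: "\<And>i j. i < K \<Longrightarrow> j < K \<Longrightarrow> M i j = M j i"
    and C: "0 < C" "\<And>x i. i < K \<Longrightarrow> (x i)\<^sup>2 \<le> C * quad_form K M x"
    and \<beta>: "0 < \<beta>" and s: "s \<noteq> 0"
    and diag: "\<And>i. i < K \<Longrightarrow> 0 \<le> M i i" "\<And>i. i < K \<Longrightarrow> \<beta> * (s\<^sup>2 * M i i) \<le> 1"
    and nondegenerate: "\<And>i. i < K \<Longrightarrow> \<beta> * (s\<^sup>2 * M i i) < 1 \<or> lo i < hi i"
    and wst: "\<And>i. wst i = s * (\<Sum>j<K. M i j * qst j)"
    and box: "\<And>i. i < K \<Longrightarrow> lo i \<le> wst i" "\<And>i. i < K \<Longrightarrow> wst i \<le> hi i"
    and opt: "\<And>i v. i < K \<Longrightarrow> lo i \<le> v \<Longrightarrow> v \<le> hi i \<Longrightarrow> 0 \<le> (v - wst i) * ((qst i + c i) / s)"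
    and select: "\<And>t. k t < K"
    and l_step: "\<And>t i. i < K \<Longrightarrow> l (Suc t) i =
        (if i = k t then max 0 (l t i + \<beta> * (lo i - s * (\<Sum>j<K. M i j * q t j))) else l t i)"
    and u_step: "\<And>t i. i < K \<Longrightarrow> u (Suc t) i =
        (if i = k t then max 0 (u t i + \<beta> * (s * (\<Sum>j<K. M i j * q t j) - hi i)) else u t i)"
    and q_step: "\<And>t i. i < K \<Longrightarrow> q (Suc t) i =
        (if i = k t then s * (l (Suc t) i - u (Suc t) i) - c i else q t i)"
    and sweeps: "\<exists>\<^sub>\<infinity>t. \<forall>i<K. k (t + i) = i"
    and i: "i < K"
  shows "(\<lambda>t. q t i) \<longlonglongrightarrow> qst i"
proof -
  \<comment> \<open>The multiplier difference for which the formula in \<open>q_step\<close> returns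
    \<open>qst\<close>.\<close>
  define mst where "mst i = (qst i + c i) / s" for i
  have qst: "qst i = s * mst i - c i" for i using s by (simp add: mst_def)
  define ok where "ok t i \<longleftrightarrow> q t i = s * (l t i - u t i) - c i \<and> 0 \<le> l t i \<and> 0 \<le> u t i" for t i
  obtain t0 where t0: "\<And>i. i < K \<Longrightarrow> k (t0 + i) = i"
    using sweeps by (auto dest: frequently_ex)
  have ok_step: "ok (Suc t) i" if "i < K" "k t = i \<or> ok t i" for t i
    using that unfolding ok_def by (cases "k t = i") (auto simp: l_step u_step q_step)
  have ok: "ok t i" if "i < K" "t0 + K \<le> t" for t i
    using \<open>t0 + K \<le> t\<close>
  proof (induction t rule: dec_induct)
    case base
    have "ok (Suc (t0 + i) + n) i" for n
      by (induction n) (use t0[OF that(1)] ok_step[OF that(1)] in auto)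
    \<comment> \<open>Node \<open>i\<close> is triggered at time \<open>t0 + i\<close>, hence
      consistent from \<open>Suc (t0 + i)\<close> on, and \<open>K - Suc i\<close> further steps
      lead to \<open>t0 + K\<close>.\<close>
    from this[of "K - Suc i"] show ?case using that(1) by simp
  next
    case (step t)
    then show ?case using ok_step[OF that(1)] by blast
  qed
  define T where "T = t0 + K"
  have okT: "ok (t + T) i" if "i < K" for t i using ok[OF that] by (simp add: T_def)
  have w: "s * (\<Sum>j<K. M i j * q (t + T) j)
      = wst i + (\<Sum>j<K. s\<^sup>2 * M i j * (l (t + T) j - u (t + T) j - mst j))" for t i
  proof -
    have "s * (\<Sum>j<K. M i j * q (t + T) j) - wst i
        = (\<Sum>j<K. s * (M i j * q (t + T) j) - s * (M i j * qst j))"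
      by (simp add: wst sum_distrib_left sum_subtractf)
    also have "\<dots> = (\<Sum>j<K. s\<^sup>2 * M i j * (l (t + T) j - u (t + T) j - mst j))"
    proof (intro sum.cong refl)
      fix j assume "j \<in> {..<K}"
      then have "q (t + T) j = s * (l (t + T) j - u (t + T) j) - c j" using okT by (simp add: ok_def)
      then show "s * (M i j * q (t + T) j) - s * (M i j * qst j)
          = s\<^sup>2 * M i j * (l (t + T) j - u (t + T) j - mst j)"
        by (simp only: qst) (simp add: power2_eq_square algebra_simps)
    qed
    finally show ?thesis by simp
  qed
  \<comment> \<open>The form of \<open>s\<^sup>2 * M\<close> is \<open>s\<^sup>2\<close> times that
    of \<open>M\<close>, which divides the coercivity constant by this factor.\<close>
  interpret dual_coordinate_ascent K "\<lambda>i j. s\<^sup>2 * M i j" \<beta> "C / s\<^sup>2" lo hi wst mst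
    "\<lambda>t. k (t + T)" "\<lambda>t. l (t + T)" "\<lambda>t. u (t + T)"
  proof
    show "(x i)\<^sup>2 \<le> C / s\<^sup>2 * quad_form K (\<lambda>i j. s\<^sup>2 * M i j) x" if "i < K" for i x
    proof -
      have "quad_form K (\<lambda>i j. s\<^sup>2 * M i j) x = s\<^sup>2 * quad_form K M x"
        unfolding quad_form_def by (simp add: sum_distrib_left algebra_simps)
      then show ?thesis using C(2)[OF that] s by simp
    qed
    show "wst i = lo i" if "i < K" "0 < mst i" for i
    proof -
      have "0 \<le> (lo i - wst i) * mst i" unfolding mst_def 
        using box[OF that(1)] by (intro opt that) auto
      then show ?thesis using that box(1)[OF that(1)] by (simp add: zero_le_mult_iff)
    qed
    show "wst i = hi i" if "i < K" "mst i < 0" for i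
    proof -
      have "0 \<le> (hi i - wst i) * mst i" unfolding mst_def 
        using box[OF that(1)] by (intro opt that) auto
      then show ?thesis using that box(2)[OF that(1)] by (simp add: zero_le_mult_iff)
    qed
    show "\<exists>\<^sub>\<infinity>t. \<forall>i<K. k (t + i + T) = i"
      unfolding INFM_nat_le
    proof
      fix m
      obtain t where t: "m + T \<le> t" "\<And>i. i < K \<Longrightarrow> k (t + i) = i"
        using sweeps unfolding INFM_nat_le by blast
      have "k (t - T + i + T) = i" if "i < K" for i using t(1) t(2)[OF that] by simp
      then show "\<exists>n\<ge>m. \<forall>i<K. k (n + i + T) = i" using t(1) by (intro exI[of _ "t - T"]) auto
    qed
    show "l (Suc t + T) i = (if i = k (t + T) then max 0 (l (t + T) i + \<beta> * (lo i - (wst i +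
        (\<Sum>j<K. s\<^sup>2 * M i j * (l (t + T) j - u (t + T) j - mst j))))) else l (t + T) i)" if "i < K" for t i
      using l_step[OF that, of "t + T"] unfolding w by simp
    show "u (Suc t + T) i = (if i = k (t + T) then max 0 (u (t + T) i + \<beta> * (wst i +
        (\<Sum>j<K. s\<^sup>2 * M i j * (l (t + T) j - u (t + T) j - mst j)) - hi i)) else u (t + T) i)" if "i < K" for t i
      using u_step[OF that, of "t + T"] unfolding w by simp
    show "s\<^sup>2 * M i j = s\<^sup>2 * M j i" if "i < K" "j < K" for i j
      using sym[OF that] by simp
    show "0 \<le> l (t + T) i" "0 \<le> u (t + T) i" if "i < K" for t i
      using okT[OF that] by (simp_all add: ok_def)
    show "0 < C / s\<^sup>2" using C(1) s by simp
    show "0 \<le> s\<^sup>2 * M i i" if "i < K" for i using diag(1)[OF that] by simp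
  qed (use \<beta> diag(2) nondegenerate box select in blast)+
  have "(\<lambda>t. s * (l (t + T) i - u (t + T) i) - c i) \<longlonglongrightarrow> s * mst i - c i"
    by (intro tendsto_intros multiplier_difference_tendsto i)
  then have "(\<lambda>t. q (t + T) i) \<longlonglongrightarrow> qst i"
    using okT[OF i] by (simp add: ok_def qst)
  then show ?thesis by (rule LIMSEQ_offset)
qed

section \<open>Positive semidefinite matrices\<close>

lemma smult_mat_mult_vec:
  fixes A :: "real mat"
  assumes "A \<in> carrier_mat nr nc" "v \<in> carrier_vec nc"
  shows "(a \<cdot>\<^sub>m A) *\<^sub>v v = a \<cdot>\<^sub>v (A *\<^sub>v v)"
  using assms by (intro eq_vecI) (auto simp: scalar_prod_def sum_distrib_left mult.assoc intro!: sum.cong)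

lemma sym_psd_mat_scalar_commute:
  assumes "sym_psd_mat n A" "x \<in> carrier_vec n" "y \<in> carrier_vec n"
  shows "x \<bullet> (A *\<^sub>v y) = y \<bullet> (A *\<^sub>v x)"
proof -
  have A: "A \<in> carrier_mat n n" "transpose_mat A = A" using assms by (auto simp: sym_psd_mat_def)
  have "x \<bullet> (A *\<^sub>v y) = (transpose_mat A *\<^sub>v x) \<bullet> y"
    using transpose_vec_mult_scalar[OF A(1) assms(3,2)] by simp
  also have "\<dots> = y \<bullet> (A *\<^sub>v x)"
    using A assms by (simp add: comm_scalar_prod[of _ n])
  finally show ?thesis .
qed

lemma sym_psd_mat_cauchy_schwarz:
  assumes A: "sym_psd_mat n A" and x: "x \<in> carrier_vec n" and y: "y \<in> carrier_vec n"
  shows "(x \<bullet> (A *\<^sub>v y))\<^sup>2 \<le> (y \<bullet> (A *\<^sub>v y)) * (x \<bullet> (A *\<^sub>v x))"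
proof -
  have An: "A \<in> carrier_mat n n" using A by (simp add: sym_psd_mat_def)
  have nonneg: "0 \<le> v \<bullet> (A *\<^sub>v v)" if "v \<in> carrier_vec n" for v
    using A that by (simp add: sym_psd_mat_def)
  define a b c where "a = x \<bullet> (A *\<^sub>v x)" and "b = x \<bullet> (A *\<^sub>v y)" and "c = y \<bullet> (A *\<^sub>v y)"
  have q: "0 \<le> a - 2 * \<tau> * b + \<tau>\<^sup>2 * c" for \<tau>
  proof -
    let ?v = "x - \<tau> \<cdot>\<^sub>v y"
    have Av: "A *\<^sub>v ?v = A *\<^sub>v x - \<tau> \<cdot>\<^sub>v (A *\<^sub>v y)"
      using An x y by (simp add: mult_minus_distrib_mat_vec[of _ n n] mult_mat_vec[of _ n n])
    have "?v \<bullet> (A *\<^sub>v ?v) = a - \<tau> * b - (\<tau> * (y \<bullet> (A *\<^sub>v x)) - \<tau> * (\<tau> * c))"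
      unfolding Av a_def b_def c_def using An x y
      by (simp add: minus_scalar_prod_distrib[of _ n] scalar_prod_minus_distrib[of _ n])
         (simp add: algebra_simps)
    also have "y \<bullet> (A *\<^sub>v x) = b" using sym_psd_mat_scalar_commute[OF A y x] by (simp add: b_def)
    finally show ?thesis using nonneg[of ?v] x y by (simp add: algebra_simps power2_eq_square)
  qed
  have "b\<^sup>2 \<le> c * a"
  proof (cases "c = 0")
    case True
    have "b = 0"
    proof (rule ccontr)
      assume "b \<noteq> 0"
      \<comment> \<open>For \<open>c = 0\<close> the polynomial is affine in \<open>\<tau>\<close>,
        and this argument gives it the value -1.\<close>
      then show False using q[of "(a + 1) / (2 * b)"] True by simp
    qed
    then show ?thesis using True by simp
  next
    case False
    then have "0 < c" using nonneg[OF y] by (simp add: c_def)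
    moreover have "a - 2 * (b / c) * b + (b / c)\<^sup>2 * c = a - b\<^sup>2 / c"
      using False by (simp add: field_simps power2_eq_square)
    ultimately have "0 < c" "b\<^sup>2 / c \<le> a" using q[of "b / c"] by simp_all
    then show ?thesis by (simp add: field_simps)
  qed
  then show ?thesis by (simp add: a_def b_def c_def)
qed

text \<open>Cauchy-Schwarz for the form of \<open>A\<close>, tested against the vector
  \<open>A *\<^sub>v x\<close> itself.\<close>

lemma sym_psd_mat_null:
  assumes A: "sym_psd_mat n A" and x: "x \<in> carrier_vec n" and "x \<bullet> (A *\<^sub>v x) = 0"
  shows "A *\<^sub>v x = 0\<^sub>v n"
proof -
  have An: "A \<in> carrier_mat n n" using A by (simp add: sym_psd_mat_def)
  then have Ax: "A *\<^sub>v x \<in> carrier_vec n" using x by simp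
  have "((A *\<^sub>v x) \<bullet> (A *\<^sub>v x))\<^sup>2 \<le> 0"
    using sym_psd_mat_cauchy_schwarz[OF A Ax x] assms(3) by simp
  then have "(A *\<^sub>v x) \<bullet> (A *\<^sub>v x) = 0" by simp
  then have "(\<Sum>i<n. ((A *\<^sub>v x) $ i)\<^sup>2) = 0" 
    using An by (simp add: scalar_prod_def power2_eq_square atLeast0LessThan)
  then have "\<forall>i<n. (A *\<^sub>v x) $ i = 0" by (subst (asm) sum_nonneg_eq_0_iff) auto
  then show ?thesis using An by (intro eq_vecI) auto
qed

lemma mat_inverse_of_trivial_kernel:
  fixes A :: "real mat"
  assumes A: "A \<in> carrier_mat n n" and ker: "\<And>x. x \<in> carrier_vec n \<Longrightarrow> A *\<^sub>v x = 0\<^sub>v n \<Longrightarrow> x = 0\<^sub>v n"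
  obtains B where "mat_inverse A = Some B" "B \<in> carrier_mat n n" "A * B = 1\<^sub>m n" "B * A = 1\<^sub>m n"
proof -
  have "det A \<noteq> 0" using ker det_0_iff_vec_prod_zero_field[OF A] by blast
  then have "A \<in> Units (ring_mat TYPE(real) n ())" by (rule det_non_zero_imp_unit[OF A])
  then obtain B where "mat_inverse A = Some B" using mat_inverse(1)[OF A, where b="()"] by (cases "mat_inverse A") auto
  with mat_inverse(2)[OF A this] that show thesis by blast
qed

text \<open>The columns \<open>y i\<close> of the inverse represent the coordinates,
  \<open>x $ i = x \<bullet> (A *\<^sub>v y i)\<close>, and Cauchy-Schwarz for the form of
  \<open>A\<close> does the rest. \<open>C\<close> is one plus the trace of the inverse; the one
  keeps it positive in dimension zero.\<close>

lemma sym_psd_mat_coercive: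
  assumes A: "sym_psd_mat n A" and ker: "\<And>x. x \<in> carrier_vec n \<Longrightarrow> A *\<^sub>v x = 0\<^sub>v n \<Longrightarrow> x = 0\<^sub>v n"
  obtains C where "0 < C" "\<And>x i. x \<in> carrier_vec n \<Longrightarrow> i < n \<Longrightarrow> (x $ i)\<^sup>2 \<le> C * (x \<bullet> (A *\<^sub>v x))"
proof -
  have An: "A \<in> carrier_mat n n" using A by (simp add: sym_psd_mat_def)
  have nonneg: "0 \<le> v \<bullet> (A *\<^sub>v v)" if "v \<in> carrier_vec n" for v
    using A that by (simp add: sym_psd_mat_def)
  obtain B where B: "B \<in> carrier_mat n n" "A * B = 1\<^sub>m n"
    using mat_inverse_of_trivial_kernel[OF An ker] by metis
  define y where "y i = B *\<^sub>v unit_vec n i" for i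
  have y: "y i \<in> carrier_vec n" for i using B by (simp add: y_def)
  have Ay: "A *\<^sub>v y i = unit_vec n i" for i
    using An B by (simp add: y_def assoc_mult_mat_vec[of _ n n _ n, symmetric])
  define C where "C = 1 + (\<Sum>i<n. y i \<bullet> (A *\<^sub>v y i))"
  have "0 < C" using nonneg[OF y] by (auto simp: C_def intro!: add_pos_nonneg sum_nonneg)
  moreover have "(x $ i)\<^sup>2 \<le> C * (x \<bullet> (A *\<^sub>v x))" if x: "x \<in> carrier_vec n" and i: "i < n" for x i
  proof -
    have "(x $ i)\<^sup>2 = (x \<bullet> (A *\<^sub>v y i))\<^sup>2" using x i by (simp add: Ay)
    also have "\<dots> \<le> (y i \<bullet> (A *\<^sub>v y i)) * (x \<bullet> (A *\<^sub>v x))" by (rule sym_psd_mat_cauchy_schwarz[OF A x y])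
    also have "y i \<bullet> (A *\<^sub>v y i) \<le> (\<Sum>i<n. y i \<bullet> (A *\<^sub>v y i))"
      using i nonneg[OF y] by (intro member_le_sum) auto
    then have "(y i \<bullet> (A *\<^sub>v y i)) * (x \<bullet> (A *\<^sub>v x)) \<le> C * (x \<bullet> (A *\<^sub>v x))"
      using nonneg[OF x] by (intro mult_right_mono) (auto simp: C_def)
    finally show ?thesis .
  qed
  ultimately show thesis using that by blast
qed

section \<open>Rayleigh quotients and the largest eigenvalue\<close>

lemma self_scalar_prod_eq_sum: "x \<in> carrier_vec n \<Longrightarrow> x \<bullet> x = (\<Sum>i<n. (x $ i)\<^sup>2)" for x :: "real vec"
  by (auto simp: scalar_prod_def power2_eq_square atLeast0LessThan)

text \<open>A crude bound whose only purpose is that some multiple of the identity dominates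
  \<open>M\<close>.\<close>

lemma quad_form_le_sum_abs:
  fixes M :: "real mat"
  assumes M: "M \<in> carrier_mat n n" and x: "x \<in> carrier_vec n"
  shows "x \<bullet> (M *\<^sub>v x) \<le> (\<Sum>i<n. \<Sum>j<n. \<bar>M $$ (i, j)\<bar>) * (x \<bullet> x)"
proof -
  have "x \<bullet> (M *\<^sub>v x) = (\<Sum>i<n. \<Sum>j<n. M $$ (i, j) * (x $ i * x $ j))"
    using M x by (auto simp: scalar_prod_def sum_distrib_left atLeast0LessThan intro!: sum.cong)
  also have "\<dots> \<le> (\<Sum>i<n. \<Sum>j<n. \<bar>M $$ (i, j)\<bar> * (x \<bullet> x))"
  proof (intro sum_mono)
    fix i j assume ij: "i \<in> {..<n}" "j \<in> {..<n}"
    have s: "(x $ i)\<^sup>2 \<le> x \<bullet> x" if "i < n" for i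
      unfolding self_scalar_prod_eq_sum[OF x] using that by (intro member_le_sum) auto
    have "2 * \<bar>x $ i * x $ j\<bar> \<le> (x $ i)\<^sup>2 + (x $ j)\<^sup>2"
      using sum_squares_bound[of "\<bar>x $ i\<bar>" "\<bar>x $ j\<bar>"] by (simp add: abs_mult)
    then have "\<bar>x $ i * x $ j\<bar> \<le> x \<bullet> x" using s[of i] s[of j] ij by simp
    then have "\<bar>M $$ (i, j)\<bar> * \<bar>x $ i * x $ j\<bar> \<le> \<bar>M $$ (i, j)\<bar> * (x \<bullet> x)"
      by (rule mult_left_mono) simp
    then show "M $$ (i, j) * (x $ i * x $ j) \<le> \<bar>M $$ (i, j)\<bar> * (x \<bullet> x)"
      by (metis abs_ge_self abs_mult order_trans)
  qed
  finally show ?thesis by (simp add: sum_distrib_right)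
qed

text \<open>The least \<open>t\<close> for which \<open>t I - M\<close> is positive semidefinite is an eigenvalue: were \<open>t I - M\<close>
  regular, it would be coercive and \<open>t\<close> could be lowered.\<close>

lemma sym_mat_rayleigh_le_Max_spectrum:
  fixes M :: "real mat"
  assumes M: "M \<in> carrier_mat n n" and sym: "transpose_mat M = M" and n: "0 < n"
    and x: "x \<in> carrier_vec n"
  shows "x \<bullet> (M *\<^sub>v x) \<le> Max (spectrum M) * (x \<bullet> x)"
proof -
  define S where "S = {t. \<forall>x\<in>carrier_vec n. x \<bullet> (M *\<^sub>v x) \<le> t * (x \<bullet> x)}"
  have S_ne: "S \<noteq> {}" using quad_form_le_sum_abs[OF M] by (auto simp: S_def)
  have "unit_vec n 0 \<bullet> (M *\<^sub>v unit_vec n 0) \<le> t" if "t \<in> S" for t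
    using that n by (auto simp: S_def dest!: bspec[where x="unit_vec n 0"])
  then have S_bdd: "bdd_below S" by (intro bdd_belowI)
  define t0 where "t0 = Inf S"
  have xx: "0 \<le> x \<bullet> x" if "x \<in> carrier_vec n" for x :: "real vec"
    using self_scalar_prod_eq_sum[OF that] by (simp add: sum_nonneg)
  have t0: "t0 \<in> S"
  proof -
    have "x \<bullet> (M *\<^sub>v x) \<le> t0 * (x \<bullet> x)" if x: "x \<in> carrier_vec n" for x
    proof (cases "x \<bullet> x = 0")
      case True
      then show ?thesis using S_ne x by (force simp: S_def)
    next
      case False
      then have "0 < x \<bullet> x" using xx[OF x] by simp
      moreover have "x \<bullet> (M *\<^sub>v x) / (x \<bullet> x) \<le> t0"
        unfolding t0_def using \<open>0 < x \<bullet> x\<close> x 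
        by (intro cInf_greatest S_ne) (auto simp: S_def field_simps)
      ultimately show ?thesis by (simp add: field_simps)
    qed
    then show ?thesis by (simp add: S_def)
  qed
  define B where "B = t0 \<cdot>\<^sub>m 1\<^sub>m n - M"
  have B: "B \<in> carrier_mat n n" using M by (simp add: B_def minus_carrier_mat)
  have Bx: "B *\<^sub>v x = t0 \<cdot>\<^sub>v x - M *\<^sub>v x" if "x \<in> carrier_vec n" for x
    unfolding B_def using that M by (simp add: minus_mult_distrib_mat_vec[of _ n n] smult_mat_mult_vec[of _ n n])
  have qB: "x \<bullet> (B *\<^sub>v x) = t0 * (x \<bullet> x) - x \<bullet> (M *\<^sub>v x)" if "x \<in> carrier_vec n" for x
    using that M by (simp add: Bx scalar_prod_minus_distrib[of _ n])
  have psd: "sym_psd_mat n B"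
    unfolding sym_psd_mat_def
  proof (intro conjI ballI B)
    have "B $$ (j, i) = B $$ (i, j)" if "i < n" "j < n" for i j
      using that M arg_cong[OF sym, of "\<lambda>M. M $$ (i, j)"] by (auto simp: B_def)
    then show "transpose_mat B = B" using B by (intro eq_matI) auto
    show "0 \<le> x \<bullet> (B *\<^sub>v x)" if "x \<in> carrier_vec n" for x
      using qB[OF that] t0 that by (simp add: S_def)
  qed
  have "\<exists>v\<in>carrier_vec n. v \<noteq> 0\<^sub>v n \<and> B *\<^sub>v v = 0\<^sub>v n"
  proof (rule ccontr)
    assume "\<not> ?thesis"
    then obtain C where C: "0 < C" 
      "\<And>x i. x \<in> carrier_vec n \<Longrightarrow> i < n \<Longrightarrow> (x $ i)\<^sup>2 \<le> C * (x \<bullet> (B *\<^sub>v x))"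
      using sym_psd_mat_coercive[OF psd] by metis
    \<comment> \<open>Summing the coercivity estimate over the \<open>n\<close> coordinates gives
      \<open>x \<bullet> x \<le> n * C * (x \<bullet> (B *\<^sub>v x))\<close>, whence the amount
      \<open>1 / (n * C)\<close>.\<close>
    have "x \<bullet> (M *\<^sub>v x) \<le> (t0 - 1 / (n * C)) * (x \<bullet> x)" if x: "x \<in> carrier_vec n" for x
    proof -
      have "x \<bullet> x \<le> (\<Sum>i<n. C * (x \<bullet> (B *\<^sub>v x)))"
        unfolding self_scalar_prod_eq_sum[OF x] using C(2)[OF x] by (intro sum_mono) auto
      then have "(x \<bullet> x) / (n * C) \<le> x \<bullet> (B *\<^sub>v x)" using n C(1) by (simp add: field_simps)
      then show ?thesis unfolding qB[OF x] by (simp add: algebra_simps)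
    qed
    then have "t0 - 1 / (n * C) \<in> S" by (simp add: S_def)
    then have "t0 \<le> t0 - 1 / (n * C)" unfolding t0_def by (rule cInf_lower[OF _ S_bdd])
    then show False using n C(1) by (simp add: field_simps)
  qed
  then obtain v where v: "v \<in> carrier_vec n" "v \<noteq> 0\<^sub>v n" "B *\<^sub>v v = 0\<^sub>v n" by blast
  have "M *\<^sub>v v = t0 \<cdot>\<^sub>v v"
  proof (intro eq_vecI)
    fix i assume "i < dim_vec (t0 \<cdot>\<^sub>v v)"
    then have "i < n" using v by simp
    then show "(M *\<^sub>v v) $ i = (t0 \<cdot>\<^sub>v v) $ i"
      using arg_cong[OF v(3)[unfolded Bx[OF v(1)]], of "\<lambda>v. v $ i"] v(1) M by simp
  qed (use v M in simp)
  then have "t0 \<in> spectrum M"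
    using v M by (auto simp: spectrum_def eigenvalue_def eigenvector_def)
  then have "t0 \<le> Max (spectrum M)"
    using card_finite_spectrum(1)[OF M] by (intro Max_ge)
  then have "t0 * (x \<bullet> x) \<le> Max (spectrum M) * (x \<bullet> x)"
    using xx[OF x] by (intro mult_right_mono)
  moreover have "x \<bullet> (M *\<^sub>v x) \<le> t0 * (x \<bullet> x)" using t0 x by (simp add: S_def)
  ultimately show ?thesis by simp
qed

lemma diag_le_Max_spectrum:
  fixes M :: "real mat"
  assumes M: "M \<in> carrier_mat n n" and sym: "transpose_mat M = M" and i: "i < n"
  shows "M $$ (i, i) \<le> Max (spectrum M)"
  using sym_mat_rayleigh_le_Max_spectrum[OF M sym _ unit_vec_carrier[of n i]] M i by simp

section \<open>The microgenerator block of the Green matrix\<close>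

lemma mult_mat_zero_vec: "A \<in> carrier_mat nr nc \<Longrightarrow> A *\<^sub>v 0\<^sub>v nc = 0\<^sub>v nr" for A :: "real mat"
  by (intro eq_vecI) auto

lemma zero_mat_mult_vec: "v \<in> carrier_vec nc \<Longrightarrow> 0\<^sub>m nr nc *\<^sub>v v = 0\<^sub>v nr" for v :: "real vec"
  by (intro eq_vecI) auto

lemma sym_psd_mat_block_quadratic:
  assumes X: "sym_psd_mat n X" and dims: "M \<in> carrier_mat k k" "N \<in> carrier_mat k r" "Q \<in> carrier_mat r r"
    and n: "n = 1 + (k + r)"
    and blocks: "X = four_block_mat (0\<^sub>m 1 1) (0\<^sub>m 1 (n - 1)) (0\<^sub>m (n - 1) 1)
                   (four_block_mat M N (transpose_mat N) Q)"
    and x: "x \<in> carrier_vec k"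
  shows "(0\<^sub>v 1 @\<^sub>v (x @\<^sub>v 0\<^sub>v r)) \<bullet> (X *\<^sub>v (0\<^sub>v 1 @\<^sub>v (x @\<^sub>v 0\<^sub>v r))) = x \<bullet> (M *\<^sub>v x)"
proof -
  let ?D = "four_block_mat M N (transpose_mat N) Q"
  have D: "?D \<in> carrier_mat (k + r) (k + r)" using dims by simp
  have Dx: "?D *\<^sub>v (x @\<^sub>v 0\<^sub>v r) = (M *\<^sub>v x) @\<^sub>v (transpose_mat N *\<^sub>v x)"
    using dims x by (subst four_block_mat_mult_vec[of _ k k _ r _ r])
      (auto simp: mult_mat_zero_vec[of _ k r] mult_mat_zero_vec[of _ r r])
  have "X *\<^sub>v (0\<^sub>v 1 @\<^sub>v (x @\<^sub>v 0\<^sub>v r)) = 0\<^sub>v 1 @\<^sub>v (?D *\<^sub>v (x @\<^sub>v 0\<^sub>v r))"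
  proof -
    have xr: "x @\<^sub>v 0\<^sub>v r \<in> carrier_vec (k + r)" using x by simp
    show ?thesis
      unfolding blocks using D xr n
      by (subst four_block_mat_mult_vec[of _ 1 1 _ "k + r" _ "k + r"])
        (auto simp: mult_mat_zero_vec[OF zero_carrier_mat] zero_mat_mult_vec[OF xr])
  qed
  then show ?thesis
    unfolding Dx using dims x
    by (simp add: scalar_prod_append[of _ 1 _ "k + r"] scalar_prod_append[of _ k _ r])
qed

lemma dim_incidence_mat [simp]:
  "dim_row (incidence_mat G) = card (arcs G)" "dim_col (incidence_mat G) = card (verts G)"
  by (simp_all add: incidence_mat_def)

lemma laplacian_mat_carrier: "laplacian_mat G z \<in> carrier_mat (card (verts G)) (card (verts G))"
  by (intro carrier_matI) (simp_all add: laplacian_mat_def)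

text \<open>\<open>X y = 0\<close> gives \<open>0 = y\<^sup>T X L = y\<^sup>T - (y\<^sup>T \<one>) \<one>\<^sub>0\<^sup>T\<close>.\<close>

lemma green_mat_kernel:
  assumes X: "green_mat G z X" and n: "card (verts G) = n"
    and y: "y \<in> carrier_vec n" "X *\<^sub>v y = 0\<^sub>v n" and i: "0 < i" "i < n"
  shows "y $ i = 0"
proof -
  let ?L = "laplacian_mat G z"
  have L: "?L \<in> carrier_mat n n" using laplacian_mat_carrier[of G z] n by simp
  have Xn: "X \<in> carrier_mat n n" "transpose_mat X = X"
    and XL: "X * ?L = 1\<^sub>m n - col_mat (ones_vec n) * transpose_mat (col_mat (unit_vec n 0))"
    using X n by (auto simp: green_mat_def sym_psd_mat_def Let_def)
  have "col (X * ?L) i = unit_vec n i"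
    unfolding XL using i
    by (intro eq_vecI) (auto simp: col_mat_def ones_vec_def scalar_prod_def unit_vec_def)
  then have "X *\<^sub>v col ?L i = unit_vec n i" using col_mult2[OF Xn(1) L i(2)] by simp
  then have "y $ i = y \<bullet> (X *\<^sub>v col ?L i)" using y(1) i by simp
  also have "\<dots> = (transpose_mat X *\<^sub>v y) \<bullet> col ?L i"
    using Xn(1) y(1) L i by (intro transpose_vec_mult_scalar[symmetric]) auto
  also have "\<dots> = 0" using Xn y L i by simp
  finally show ?thesis .
qed

text \<open>\<open>X\<close> is singular, but its kernel is confined to node 0. If
  \<open>M *\<^sub>v x = 0\<close>, padding \<open>x\<close> with zeros gives a vector on which the
  form of \<open>X\<close> vanishes, hence a kernel vector of \<open>X\<close>, and its entries away
  from node 0 are zero.\<close>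

lemma green_block_sym_psd:
  assumes X: "green_mat G z X" and n: "card (verts G) = n" "n = 1 + (k + r)"
    and dims: "M \<in> carrier_mat k k" "N \<in> carrier_mat k r" "Q \<in> carrier_mat r r"
    and blocks: "X = four_block_mat (0\<^sub>m 1 1) (0\<^sub>m 1 (n - 1)) (0\<^sub>m (n - 1) 1)
                   (four_block_mat M N (transpose_mat N) Q)"
  shows "sym_psd_mat k M" and "\<And>x. x \<in> carrier_vec k \<Longrightarrow> M *\<^sub>v x = 0\<^sub>v k \<Longrightarrow> x = 0\<^sub>v k"
proof -
  have psd: "sym_psd_mat n X" using X n by (simp add: green_mat_def Let_def)
  note quad = sym_psd_mat_block_quadratic[OF psd dims n(2) blocks]
  have ext: "0\<^sub>v 1 @\<^sub>v (x @\<^sub>v 0\<^sub>v r) \<in> carrier_vec n" if "x \<in> carrier_vec k" for x :: "real vec"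
    using append_carrier_vec[of "0\<^sub>v 1" 1 "x @\<^sub>v 0\<^sub>v r" "k + r"] append_carrier_vec[OF that, of "0\<^sub>v r" r] n(2)
    by simp
  show "sym_psd_mat k M"
    unfolding sym_psd_mat_def
  proof (intro conjI ballI dims)
    have "M $$ (i, j) = X $$ (1 + i, 1 + j)" if "i < k" "j < k" for i j
      unfolding blocks using that dims n(2) by simp
    moreover have "X $$ (i, j) = X $$ (j, i)" if "i < n" "j < n" for i j
      using psd that by (metis carrier_matD index_transpose_mat(1) sym_psd_mat_def)
    ultimately have "M $$ (i, j) = M $$ (j, i)" if "i < k" "j < k" for i j
      using that n(2) by simp
    then show "transpose_mat M = M" using dims by (intro eq_matI) auto
    show "0 \<le> x \<bullet> (M *\<^sub>v x)" if "x \<in> carrier_vec k" for x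
      using quad[OF that] ext[OF that] psd by (metis sym_psd_mat_def)
  qed
  show "x = 0\<^sub>v k" if x: "x \<in> carrier_vec k" and Mx: "M *\<^sub>v x = 0\<^sub>v k" for x
  proof -
    let ?y = "0\<^sub>v 1 @\<^sub>v (x @\<^sub>v 0\<^sub>v r)"
    have "?y \<bullet> (X *\<^sub>v ?y) = 0" using quad[OF x] Mx x by simp
    then have "X *\<^sub>v ?y = 0\<^sub>v n" by (rule sym_psd_mat_null[OF psd ext[OF x]])
    then have "?y $ (1 + i) = 0" if "i < k" for i
      using green_mat_kernel[OF X n(1) ext[OF x]] that n(2) by simp
    then show ?thesis using x by (intro eq_vecI) auto
  qed
qed

section \<open>The quadratic program\<close>

lemma mult_mat_vec_index_sum:
  assumes "M \<in> carrier_mat k k" "x \<in> carrier_vec k" "i < k"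
  shows "(M *\<^sub>v x) $ i = (\<Sum>j<k. M $$ (i, j) * x $ j)"
  using assms by (auto simp: scalar_prod_def atLeast0LessThan)

lemma quad_form_mat_eq:
  assumes "M \<in> carrier_mat k k"
  shows "quad_form k (\<lambda>i j. M $$ (i, j)) x = vec k x \<bullet> (M *\<^sub>v vec k x)"
  using assms
  by (auto simp: quad_form_def scalar_prod_def atLeast0LessThan intro!: sum.cong)

text \<open>The transposed constraint matrix factors through \<open>M\<close>, so the inverse of
  \<open>M\<close> in the update of \<open>q\<close> cancels and each node needs only its own two
  multipliers.\<close>

lemma transpose_append_rows_mult_append:
  fixes M :: "real mat"
  assumes M: "M \<in> carrier_mat k k" "transpose_mat M = M" and ab: "a \<in> carrier_vec k" "b \<in> carrier_vec k"
  shows "transpose_mat (((- s) \<cdot>\<^sub>m M) @\<^sub>r (s \<cdot>\<^sub>m M)) *\<^sub>v (a @\<^sub>v b) = M *\<^sub>v (s \<cdot>\<^sub>v (b - a))"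
proof -
  let ?\<Phi> = "((- s) \<cdot>\<^sub>m M) @\<^sub>r (s \<cdot>\<^sub>m M)"
  have \<Phi>: "?\<Phi> \<in> carrier_mat (k + k) k" using M by simp
  have Ms: "M $$ (j, i) = M $$ (i, j)" if "i < k" "j < k" for i j
    using that M(1) arg_cong[OF M(2), of "\<lambda>A. A $$ (i, j)"] by simp
  show ?thesis
  proof (rule eq_vecI)
    fix i assume "i < dim_vec (M *\<^sub>v (s \<cdot>\<^sub>v (b - a)))"
    then have i: "i < k" using M by simp
    have c: "col ?\<Phi> i = ((- s) \<cdot>\<^sub>v row M i) @\<^sub>v (s \<cdot>\<^sub>v row M i)"
      using M i by (intro eq_vecI) (auto simp: append_rows_def Ms)
    have "(transpose_mat ?\<Phi> *\<^sub>v (a @\<^sub>v b)) $ i = col ?\<Phi> i \<bullet> (a @\<^sub>v b)"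
      using \<Phi> i by simp
    also have "\<dots> = ((- s) \<cdot>\<^sub>v row M i) \<bullet> a + (s \<cdot>\<^sub>v row M i) \<bullet> b"
      unfolding c using M ab i by (intro scalar_prod_append[of _ k _ k]) auto
    also have "\<dots> = (M *\<^sub>v (s \<cdot>\<^sub>v (b - a))) $ i"
      using M ab i by (simp add: scalar_prod_minus_distrib[of _ k] right_diff_distrib)
    finally show "(transpose_mat ?\<Phi> *\<^sub>v (a @\<^sub>v b)) $ i = (M *\<^sub>v (s \<cdot>\<^sub>v (b - a))) $ i" .
  qed (use M carrier_matD(2)[OF \<Phi>] in simp)
qed

lemma append_rows_constraint_iff:
  fixes M :: "real mat"
  assumes M: "M \<in> carrier_mat k k" and lh: "lo \<in> carrier_vec k" "hi \<in> carrier_vec k"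
    and x: "x \<in> carrier_vec k"
  shows "(((- s) \<cdot>\<^sub>m M) @\<^sub>r (s \<cdot>\<^sub>m M)) *\<^sub>v x + (lo @\<^sub>v (- hi)) \<le> 0\<^sub>v (2 * k)
           \<longleftrightarrow> (\<forall>i<k. lo $ i \<le> s * (M *\<^sub>v x) $ i \<and> s * (M *\<^sub>v x) $ i \<le> hi $ i)"
    (is "?l \<longleftrightarrow> ?r")
proof -
  have Mx: "M *\<^sub>v x \<in> carrier_vec k" using M x by simp
  have e: "(((- s) \<cdot>\<^sub>m M) @\<^sub>r (s \<cdot>\<^sub>m M)) *\<^sub>v x + (lo @\<^sub>v (- hi))
      = (lo - s \<cdot>\<^sub>v (M *\<^sub>v x)) @\<^sub>v (s \<cdot>\<^sub>v (M *\<^sub>v x) - hi)"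
  proof -
    have Mx': "((- s) \<cdot>\<^sub>m M) *\<^sub>v x = - s \<cdot>\<^sub>v (M *\<^sub>v x)" "(s \<cdot>\<^sub>m M) *\<^sub>v x = s \<cdot>\<^sub>v (M *\<^sub>v x)"
      using smult_mat_mult_vec[OF M x] by auto
    have sM: "(- s) \<cdot>\<^sub>m M \<in> carrier_mat k k" "s \<cdot>\<^sub>m M \<in> carrier_mat k k" using M by auto
    show ?thesis
      unfolding mat_mult_append[OF sM x] Mx' using lh M by (intro eq_vecI) auto
  qed
  have z: "0\<^sub>v (2 * k) = 0\<^sub>v k @\<^sub>v (0\<^sub>v k :: real vec)" by (intro eq_vecI) auto
  have "?l \<longleftrightarrow> lo - s \<cdot>\<^sub>v (M *\<^sub>v x) \<le> 0\<^sub>v k \<and> s \<cdot>\<^sub>v (M *\<^sub>v x) - hi \<le> 0\<^sub>v k"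
    unfolding e z using lh Mx by (intro append_vec_le[of _ k]) auto
  also have "\<dots> \<longleftrightarrow> ?r"
    using lh M by (auto simp: less_eq_vec_def)
  finally show ?thesis .
qed

lemma nonneg_slope_of_min:
  fixes g h :: real
  assumes "\<And>r. 0 < r \<Longrightarrow> r \<le> 1 \<Longrightarrow> 0 \<le> r * g + r\<^sup>2 * h"
  shows "0 \<le> g"
proof (rule ccontr)
  assume g: "\<not> 0 \<le> g"
  \<comment> \<open>Chosen so that \<open>r * h \<le> - g / 2\<close>, which makes
    \<open>g + r * h \<le> g / 2 < 0\<close>.\<close>
  define r where "r = min 1 (- g / (2 * (\<bar>h\<bar> + 1)))"
  have r: "0 < r" "r \<le> 1" using g by (auto simp: r_def intro: divide_neg_pos)
  have "0 \<le> r * (g + r * h)" using assms[OF r] by (simp add: power2_eq_square algebra_simps)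
  then have "0 \<le> g + r * h" using r by (simp add: zero_le_mult_iff)
  moreover have "r * h \<le> r * (\<bar>h\<bar> + 1)" using r by (intro mult_left_mono) auto
  moreover have "r * (\<bar>h\<bar> + 1) \<le> (- g / (2 * (\<bar>h\<bar> + 1))) * (\<bar>h\<bar> + 1)"
    by (intro mult_right_mono) (auto simp: r_def)
  moreover have "\<dots> = - g / 2" by (simp add: field_simps)
  ultimately show False using g by linarith
qed

text \<open>In the variable \<open>w = s M x\<close> the feasible set is a box, so optimality can be tested along the
  single coordinates of \<open>w\<close>, that is, along the columns of \<open>M\<^sup>-\<^sup>1\<close>.\<close>

lemma box_qp_variational_inequality:
  fixes M :: "real mat"
  assumes M: "sym_psd_mat k M" and B: "B \<in> carrier_mat k k" "M * B = 1\<^sub>m k" and s: "s \<noteq> 0"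
    and d: "d \<in> carrier_vec k" and x: "x \<in> carrier_vec k"
    and feas: "\<And>i. i < k \<Longrightarrow> lo $ i \<le> s * (M *\<^sub>v x) $ i \<and> s * (M *\<^sub>v x) $ i \<le> hi $ i"
    and opt: "\<And>y. y \<in> carrier_vec k \<Longrightarrow>
        (\<forall>i<k. lo $ i \<le> s * (M *\<^sub>v y) $ i \<and> s * (M *\<^sub>v y) $ i \<le> hi $ i) \<Longrightarrow>
        1 / 2 * (x \<bullet> (M *\<^sub>v x)) + x \<bullet> d \<le> 1 / 2 * (y \<bullet> (M *\<^sub>v y)) + y \<bullet> d"
    and i: "i < k" and u: "lo $ i \<le> u" "u \<le> hi $ i"
  shows "0 \<le> (u - s * (M *\<^sub>v x) $ i) * ((x $ i + (B *\<^sub>v d) $ i) / s)"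
proof -
  have Mk: "M \<in> carrier_mat k k" using M by (simp add: sym_psd_mat_def)
  define e where "e = B *\<^sub>v unit_vec k i"
  define w where "w = s * (M *\<^sub>v x) $ i"
  \<comment> \<open>Moving \<open>x\<close> by \<open>\<delta>\<close> along \<open>e\<close>
    changes \<open>s * (M *\<^sub>v x)\<close> in coordinate \<open>i\<close> only, from
    \<open>w\<close> to \<open>u\<close>; the fractions \<open>r\<close> of this move stay feasible
    because the box is convex.\<close>
  define \<delta> where "\<delta> = (u - w) / s"
  have e: "e \<in> carrier_vec k" using B by (simp add: e_def)
  have MB: "M *\<^sub>v (B *\<^sub>v v) = v" if "v \<in> carrier_vec k" for v
    using that Mk B by (simp add: assoc_mult_mat_vec[of _ k k _ k, symmetric])
  have Me: "M *\<^sub>v e = unit_vec k i" unfolding e_def by (intro MB) simp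
  have "e \<bullet> (M *\<^sub>v x) = x $ i"
    using sym_psd_mat_scalar_commute[OF M e x] x i by (simp add: Me)
  moreover have "e \<bullet> d = (B *\<^sub>v d) $ i"
    using sym_psd_mat_scalar_commute[OF M e, of "B *\<^sub>v d"] MB[OF d] B d i by (simp add: Me)
  ultimately have lin: "e \<bullet> (M *\<^sub>v x) + e \<bullet> d = x $ i + (B *\<^sub>v d) $ i" by simp
  have "0 \<le> r * (\<delta> * (x $ i + (B *\<^sub>v d) $ i)) + r\<^sup>2 * (\<delta>\<^sup>2 * (e \<bullet> (M *\<^sub>v e)) / 2)"
    if r: "0 < r" "r \<le> 1" for r
  proof -
    define a where "a = r * \<delta>"
    let ?y = "x + a \<cdot>\<^sub>v e"
    have My: "M *\<^sub>v ?y = M *\<^sub>v x + a \<cdot>\<^sub>v unit_vec k i"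
      using Mk x e by (simp add: mult_add_distrib_mat_vec[of _ k k] mult_mat_vec[of _ k k] Me)
    have sMy: "s * (M *\<^sub>v ?y) $ j = s * (M *\<^sub>v x) $ j + (if j = i then r * (u - w) else 0)"
      if "j < k" for j
    proof -
      have "s * a = r * (u - w)" using s by (simp add: a_def \<delta>_def)
      then show ?thesis unfolding My using that Mk i by (simp add: distrib_left)
    qed
    have conv: "lo $ i \<le> w + r * (u - w) \<and> w + r * (u - w) \<le> hi $ i"
    proof -
      have "w + r * (u - w) = (1 - r) * w + r * u" by (simp add: algebra_simps)
      moreover have "(1 - r) * lo $ i + r * lo $ i \<le> (1 - r) * w + r * u"
        using feas[OF i] u r by (intro add_mono mult_left_mono) (auto simp: w_def)
      moreover have "(1 - r) * w + r * u \<le> (1 - r) * hi $ i + r * hi $ i"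
        using feas[OF i] u r by (intro add_mono mult_left_mono) (auto simp: w_def)
      ultimately show ?thesis by (simp add: algebra_simps)
    qed
    have "1 / 2 * (x \<bullet> (M *\<^sub>v x)) + x \<bullet> d \<le> 1 / 2 * (?y \<bullet> (M *\<^sub>v ?y)) + ?y \<bullet> d"
    proof (rule opt)
      show "\<forall>j<k. lo $ j \<le> s * (M *\<^sub>v ?y) $ j \<and> s * (M *\<^sub>v ?y) $ j \<le> hi $ j"
        using feas conv unfolding w_def by (auto simp: sMy[unfolded w_def])
    qed (use x e in simp)
    also have "?y \<bullet> (M *\<^sub>v ?y) = x \<bullet> (M *\<^sub>v x) + 2 * a * (e \<bullet> (M *\<^sub>v x)) + a\<^sup>2 * (e \<bullet> (M *\<^sub>v e))"
    proof -
      have "?y \<bullet> (M *\<^sub>v ?y) = ?y \<bullet> (M *\<^sub>v x + a \<cdot>\<^sub>v (M *\<^sub>v e))" by (simp add: My Me)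
      also have "\<dots> = x \<bullet> (M *\<^sub>v x) + a * (x \<bullet> (M *\<^sub>v e)) + (a * (e \<bullet> (M *\<^sub>v x)) + a * (a * (e \<bullet> (M *\<^sub>v e))))"
        using Mk x e
        by (simp add: add_scalar_prod_distrib[of _ k] scalar_prod_add_distrib[of _ k] algebra_simps)
      finally show ?thesis
        using sym_psd_mat_scalar_commute[OF M x e] by (simp add: power2_eq_square)
    qed
    also have "?y \<bullet> d = x \<bullet> d + a * (e \<bullet> d)"
      using x e d by (simp add: add_scalar_prod_distrib[of _ k])
    finally have "0 \<le> a * (e \<bullet> (M *\<^sub>v x) + e \<bullet> d) + a\<^sup>2 * (e \<bullet> (M *\<^sub>v e)) / 2"
      by (simp add: algebra_simps)
    then show ?thesis unfolding lin by (simp add: a_def power_mult_distrib algebra_simps)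
  qed
  then have "0 \<le> \<delta> * (x $ i + (B *\<^sub>v d) $ i)" by (rule nonneg_slope_of_min)
  then show ?thesis by (simp add: \<delta>_def w_def)
qed


section \<open>Recurrence of words in uniform sequences\<close>

text \<open>By continuity from above the limes superior has probability at least
  \<open>c > 0\<close>, and Borel's zero-one law leaves only probability one.\<close>

lemma (in prob_space) indep_events_infinitely_often:
  assumes indep: "indep_events (\<lambda>j. {x \<in> space M. Q j x}) (UNIV :: nat set)"
    and c: "0 < c" "\<And>j. c \<le> prob {x \<in> space M. Q j x}"
  shows "AE x in M. \<exists>\<^sub>\<infinity>j. Q j x"
proof -
  have [measurable]: "{x \<in> space M. Q j x} \<in> events" for j
    using indep by (auto simp: indep_events_def)
  define F where "F n = (\<Union>j\<in>{n..}. {x \<in> space M. Q j x})" for n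
  have F: "F n \<in> events" for n unfolding F_def by measurable
  have lim: "(\<lambda>n. prob (F n)) \<longlonglongrightarrow> prob (\<Inter>n. F n)"
    by (rule finite_Lim_measure_decseq) (use F in \<open>fastforce simp: decseq_def F_def\<close>)+
  have "c \<le> prob (F n)" for n
    by (rule order_trans[OF c(2)[of n]], rule finite_measure_mono) (use F in \<open>auto simp: F_def\<close>)
  then have "c \<le> prob (\<Inter>n. F n)" by (intro LIMSEQ_le_const[OF lim]) auto
  then have "\<not> (AE x in M. finite {j. Q j x})"
  proof (rule contrapos_pn)
    assume "AE x in M. finite {j. Q j x}"
    then have "AE x in M. x \<notin> (\<Inter>n. F n)"
    proof eventually_elim
      case (elim x)
      then obtain n where "{j. Q j x} \<subseteq> {..<n}" by (auto simp: finite_nat_iff_bounded)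
      then have "x \<notin> F n" by (auto simp: F_def not_less[symmetric])
      then show ?case by blast
    qed
    then have "prob (\<Inter>n. F n) = 0" using F by (subst prob_eq_0) auto
    then show "\<not> c \<le> prob (\<Inter>n. F n)" using c(1) by simp
  qed
  then show ?thesis
    using borel_0_1_law_AE[OF indep] by (simp add: frequently_cofinite)
qed

text \<open>Occurrences at overlapping positions are dependent, so time is cut into disjoint blocks
  of length \<open>K\<close>. The events that a whole block spells the word are independent, each
  with probability \<open>p ^ K\<close>.\<close>

lemma (in prob_space) iid_uniform_word_infinitely_often:
  fixes h :: "nat \<Rightarrow> 'a \<Rightarrow> 'b" and f :: "nat \<Rightarrow> 'b"
  assumes indep: "indep_vars (\<lambda>_. count_space S) h UNIV"
    and uniform: "\<And>t. distr M (count_space S) (h t) = uniform_count_measure S"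
    and S: "finite S" and f: "\<And>i. i < K \<Longrightarrow> f i \<in> S" and K: "0 < K"
  shows "AE x in M. \<exists>\<^sub>\<infinity>t. \<forall>i<K. h (t + i) x = f i"
proof -
  define p where "p = 1 / real (card S)"
  have S_ne: "S \<noteq> {}" using f[OF K] by auto
  then have p: "0 < p" using S by (simp add: p_def card_gt_0_iff)
  have rv: "h t \<in> measurable M (count_space S)" for t
    using indep by (auto simp: indep_vars_def)
  have single: "prob (h t -` {a} \<inter> space M) = p" if "a \<in> S" for t a
  proof -
    have "prob (h t -` {a} \<inter> space M) = measure (distr M (count_space S) (h t)) {a}"
      using that rv by (simp add: measure_distr)
    then show ?thesis
      using that S by (simp add: uniform measure_uniform_count_measure p_def)
  qed
  define B where "B j = {j * K..<j * K + K}" for j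
  define W where "W j x \<longleftrightarrow> (\<forall>i<K. h (j * K + i) x = f i)" for j x
  have B_disj: "B i \<inter> B j = {}" if "i \<noteq> j" for i j
  proof -
    have "t div K = j" if "t \<in> B j" for t j
    proof -
      obtain r where "t = j * K + r" "r < K"
        using \<open>t \<in> B j\<close> by (auto simp: B_def le_iff_add)
      then show ?thesis by simp
    qed
    then show ?thesis using that by blast
  qed
  have B_ne: "B j \<noteq> {}" for j using K by (simp add: B_def)
  have W_iff: "W j x \<longleftrightarrow> (\<forall>t\<in>B j. h t x = f (t mod K))" for j x
  proof
    assume W: "W j x"
    show "\<forall>t\<in>B j. h t x = f (t mod K)"
    proof
      fix t assume "t \<in> B j"
      then obtain r where "t = j * K + r" "r < K" by (auto simp: B_def le_iff_add)
      then show "h t x = f (t mod K)" using W by (simp add: W_def)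
    qed
  next
    assume *: "\<forall>t\<in>B j. h t x = f (t mod K)"
    show "W j x" unfolding W_def
    proof (intro allI impI)
      fix i assume "i < K"
      then show "h (j * K + i) x = f i" using bspec[OF *, of "j * K + i"] by (simp add: B_def)
    qed
  qed
  \<comment> \<open>Singletons \<open>J\<close> give the probability of one block, general
    \<open>J\<close> the product formula for independence.\<close>
  have prob_blocks: "prob (\<Inter>j\<in>J. {x \<in> space M. W j x}) = p ^ (K * card J)"
    if J: "finite J" "J \<noteq> {}" for J
  proof -
    obtain j0 t0 where "j0 \<in> J" "t0 \<in> B j0" using J(2) B_ne by blast
    then have "(\<Inter>j\<in>J. {x \<in> space M. W j x}) = (\<Inter>t\<in>(\<Union>j\<in>J. B j). h t -` {f (t mod K)} \<inter> space M)"
      by (auto simp: W_iff)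
    also have "prob \<dots> = (\<Prod>t\<in>(\<Union>j\<in>J. B j). prob (h t -` {f (t mod K)} \<inter> space M))"
      using J K f by (intro indep_varsD[OF indep]) (auto simp: B_def)
    also have "\<dots> = (\<Prod>t\<in>(\<Union>j\<in>J. B j). p)"
      using K f by (intro prod.cong refl single) auto
    also have "\<dots> = p ^ card (\<Union>j\<in>J. B j)" by simp
    also have "card (\<Union>j\<in>J. B j) = (\<Sum>j\<in>J. card (B j))"
      using J B_disj by (intro card_UN_disjoint) (auto simp: B_def)
    finally show ?thesis by (simp add: B_def mult.commute)
  qed
  have events: "{x \<in> space M. W j x} \<in> events" for j
  proof -
    have "h t -` {f (t mod K)} \<inter> space M \<in> events" for t
      using K f by (intro measurable_sets[OF rv]) auto
    then have "(\<Inter>t\<in>B j. h t -` {f (t mod K)} \<inter> space M) \<in> events"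
      using B_ne[of j] by (intro sets.finite_INT) (auto simp: B_def)
    also have "(\<Inter>t\<in>B j. h t -` {f (t mod K)} \<inter> space M) = {x \<in> space M. W j x}"
      using B_ne[of j] by (auto simp: W_iff)
    finally show ?thesis .
  qed
  have "indep_events (\<lambda>j. {x \<in> space M. W j x}) UNIV"
    unfolding indep_events_def
  proof (intro conjI allI impI)
    fix J :: "nat set" assume J: "J \<subseteq> UNIV" "J \<noteq> {}" "finite J"
    have "prob {x \<in> space M. W j x} = p ^ K" for j
      using prob_blocks[of "{j}"] by simp
    then show "prob (\<Inter>j\<in>J. {x \<in> space M. W j x}) = (\<Prod>j\<in>J. prob {x \<in> space M. W j x})"
      using prob_blocks[of J] J by (simp add: power_mult)
  qed (use events in auto)
  then have "AE x in M. \<exists>\<^sub>\<infinity>j. W j x"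
    by (rule indep_events_infinitely_often[where c="p ^ K"])
       (use p prob_blocks[of "{_}"] in auto)
  then show ?thesis
  proof eventually_elim
    case (elim x)
    show ?case
      unfolding INFM_nat_le
    proof
      fix T
      obtain j where j: "T \<le> j" "W j x" using elim by (auto simp: INFM_nat_le)
      have "j \<le> j * K" using K by simp
      with j(1) have "T \<le> j * K" by (rule le_trans)
      then show "\<exists>t\<ge>T. \<forall>i<K. h (t + i) x = f i"
        using j(2) unfolding W_def by blast
    qed
  qed
qed

section \<open>Convergence\<close>

theorem proposition3:
  fixes G :: "(nat, nat) pre_digraph"
    and z :: "nat \<Rightarrow> complex"
    and n m :: nat
    and \<theta> U_N U_min U_max v_min v_max \<sigma>_max \<gamma> :: real
    and X M N Q \<Phi> :: "real mat"
    and p_G p_L q_L b_min b_max b q_opt :: "real vec"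
    and P :: "'w measure"
    and h :: "nat \<Rightarrow> 'w \<Rightarrow> nat"
    and q lam_min lam_max \<nu> :: "nat \<Rightarrow> 'w \<Rightarrow> real vec"
  assumes graph: "fin_digraph G" "loopfree_digraph G" "Digraph_Component.connected G"
    and nodes: "verts G = {0..<n}"
    and edges: "arcs G = {0..<card (arcs G)}"
    and agents: "2 \<le> m" "m \<le> n"
    and impedances: "\<forall>e \<in> arcs G. 0 < cmod (z e) \<and> z e = exp (\<i> * of_real \<theta>) * of_real (cmod (z e))"
    and angle: "sin \<theta> \<noteq> 0"
    and X: "green_mat G z X"
    and blocks_dim: "M \<in> carrier_mat (m - 1) (m - 1)" "N \<in> carrier_mat (m - 1) (n - m)"
      "Q \<in> carrier_mat (n - m) (n - m)"
    and blocks: "X = four_block_mat (0\<^sub>m 1 1) (0\<^sub>m 1 (n - 1)) (0\<^sub>m (n - 1) 1)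
                   (four_block_mat M N (transpose_mat N) Q)"
    and \<sigma>_max: "\<sigma>_max = Max (spectrum M)"
    and powers: "p_G \<in> carrier_vec (m - 1)" "p_L \<in> carrier_vec (n - m)" "q_L \<in> carrier_vec (n - m)"
    and U_N: "0 < U_N"
    and v_min: "v_min = U_min\<^sup>2 / U_N\<^sup>2"
    and v_max: "v_max = U_max\<^sup>2 / U_N\<^sup>2"
    and b_min: "b_min = (U_N\<^sup>2 / 2 * (v_min - 1)) \<cdot>\<^sub>v ones_vec (m - 1)
                  - (cos \<theta> \<cdot>\<^sub>v (M *\<^sub>v p_G) + N *\<^sub>v (cos \<theta> \<cdot>\<^sub>v p_L + sin \<theta> \<cdot>\<^sub>v q_L))"
    and b_max: "b_max = (U_N\<^sup>2 / 2 * (v_max - 1)) \<cdot>\<^sub>v ones_vec (m - 1)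
                  - (cos \<theta> \<cdot>\<^sub>v (M *\<^sub>v p_G) + N *\<^sub>v (cos \<theta> \<cdot>\<^sub>v p_L + sin \<theta> \<cdot>\<^sub>v q_L))"
    and \<Phi>: "\<Phi> = ((- sin \<theta>) \<cdot>\<^sub>m M) @\<^sub>r (sin \<theta> \<cdot>\<^sub>m M)"
    and b: "b = b_min @\<^sub>v (- b_max)"
    and feasible: "\<exists>x \<in> carrier_vec (m - 1). \<Phi> *\<^sub>v x + b \<le> 0\<^sub>v (2 * (m - 1))"
    and optimal: "is_arg_min (\<lambda>x. 1 / 2 * (x \<bullet> (M *\<^sub>v x)) + x \<bullet> (N *\<^sub>v q_L))
                    (\<lambda>x. x \<in> carrier_vec (m - 1) \<and> \<Phi> *\<^sub>v x + b \<le> 0\<^sub>v (2 * (m - 1))) q_opt"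
    and prob: "prob_space P"
    and h_indep: "prob_space.indep_vars P (\<lambda>_. count_space {1..<m}) h UNIV"
    and h_uniform: "\<And>t. distr P (count_space {1..<m}) (h t) = uniform_count_measure {1..<m}"
    and state_dim: "\<And>t \<omega>. \<omega> \<in> space P \<Longrightarrow> q t \<omega> \<in> carrier_vec (m - 1) \<and>
          lam_min t \<omega> \<in> carrier_vec (m - 1) \<and> lam_max t \<omega> \<in> carrier_vec (m - 1)"
    and \<nu>: "\<And>t \<omega>. \<nu> t \<omega> = lam_min t \<omega> @\<^sub>v lam_max t \<omega>"
    and lam_min_update: "\<And>t \<omega>. \<omega> \<in> space P \<Longrightarrow>
          lam_min (Suc t) \<omega> $ (h t \<omega> - 1) =
            pos_part (lam_min t \<omega> $ (h t \<omega> - 1) + \<gamma> * (2 / U_N\<^sup>2) *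
              (unit_vec (m - 1) (h t \<omega> - 1) \<bullet> (b_min - sin \<theta> \<cdot>\<^sub>v (M *\<^sub>v q t \<omega>))))"
    and lam_max_update: "\<And>t \<omega>. \<omega> \<in> space P \<Longrightarrow>
          lam_max (Suc t) \<omega> $ (h t \<omega> - 1) =
            pos_part (lam_max t \<omega> $ (h t \<omega> - 1) + \<gamma> * (2 / U_N\<^sup>2) *
              (unit_vec (m - 1) (h t \<omega> - 1) \<bullet> (sin \<theta> \<cdot>\<^sub>v (M *\<^sub>v q t \<omega>) - b_max)))"
    and q_update: "\<And>t \<omega>. \<omega> \<in> space P \<Longrightarrow>
          q (Suc t) \<omega> $ (h t \<omega> - 1) =
            - (unit_vec (m - 1) (h t \<omega> - 1) \<bullet>
                (the (mat_inverse M) *\<^sub>v (N *\<^sub>v q_L)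
                 + the (mat_inverse M) *\<^sub>v (transpose_mat \<Phi> *\<^sub>v \<nu> (Suc t) \<omega>)))"
    and not_triggered: "\<And>t \<omega> k. \<omega> \<in> space P \<Longrightarrow> k \<in> {1..<m} \<Longrightarrow> k \<noteq> h t \<omega> \<Longrightarrow>
          lam_min (Suc t) \<omega> $ (k - 1) = lam_min t \<omega> $ (k - 1) \<and>
          lam_max (Suc t) \<omega> $ (k - 1) = lam_max t \<omega> $ (k - 1) \<and>
          q (Suc t) \<omega> $ (k - 1) = q t \<omega> $ (k - 1)"
    and \<gamma>_pos: "0 < \<gamma>"
    and \<gamma>_bound: "\<gamma> \<le> U_N\<^sup>2 / (2 * (sin \<theta>)\<^sup>2 * \<sigma>_max)"
    and \<gamma>_bound_degenerate: "U_min\<^sup>2 = U_max\<^sup>2 \<Longrightarrow> \<gamma> \<noteq> U_N\<^sup>2 / (2 * (sin \<theta>)\<^sup>2 * \<sigma>_max)"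
  shows "AE \<omega> in P. \<forall>i < m - 1. (\<lambda>t. q t \<omega> $ i) \<longlonglongrightarrow> q_opt $ i"
proof -
  define K where "K = m - 1"
  define s where "s = sin \<theta>"
  \<comment> \<open>The effective step size; in terms of it the bound on \<open>\<gamma>\<close>
    reads \<open>\<beta> * (s\<^sup>2 * \<sigma>_max) \<le> 1\<close>.\<close>
  define \<beta> where "\<beta> = \<gamma> * (2 / U_N\<^sup>2)"
  have K: "0 < K" "n = 1 + (K + (n - m))" using agents by (auto simp: K_def)
  have s: "s \<noteq> 0" using angle by (simp add: s_def)
  have Mk: "M \<in> carrier_mat K K" and Nk: "N \<in> carrier_mat K (n - m)"
    using blocks_dim by (simp_all add: K_def)
  have card_verts: "card (verts G) = n" by (simp add: nodes)
  note green = green_block_sym_psd[OF X card_verts K(2) Mk Nk blocks_dim(3) blocks]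
  note psd = green(1)
  have Msym: "transpose_mat M = M" using psd by (simp add: sym_psd_mat_def)
  have Mij: "M $$ (i, j) = M $$ (j, i)" if "i < K" "j < K" for i j
    using that Mk arg_cong[OF Msym, of "\<lambda>A. A $$ (i, j)"] by simp
  obtain B where B: "mat_inverse M = Some B" "B \<in> carrier_mat K K" "M * B = 1\<^sub>m K" "B * M = 1\<^sub>m K"
    using mat_inverse_of_trivial_kernel[OF Mk green(2)] by metis
  obtain C where C: "0 < C" "\<And>x i. x \<in> carrier_vec K \<Longrightarrow> i < K \<Longrightarrow> (x $ i)\<^sup>2 \<le> C * (x \<bullet> (M *\<^sub>v x))"
    using sym_psd_mat_coercive[OF psd green(2)] by metis
  define d where "d = N *\<^sub>v q_L"
  define c where "c = B *\<^sub>v d"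
  have d: "d \<in> carrier_vec K" and c: "c \<in> carrier_vec K" using Nk B powers by (simp_all add: d_def c_def)
  have bk: "b_min \<in> carrier_vec K" "b_max \<in> carrier_vec K"
    using Mk Nk powers unfolding b_min b_max by (auto simp: ones_vec_def K_def)

  have M_pos: "0 < M $$ (i, i)" if "i < K" for i
  proof -
    have "1 \<le> C * M $$ (i, i)" using C(2)[of "unit_vec K i" i] that Mk by simp
    then have "0 < C * M $$ (i, i)" by linarith
    then show ?thesis by (rule zero_less_mult_pos[OF _ C(1)])
  qed
  have M_le: "M $$ (i, i) \<le> \<sigma>_max" if "i < K" for i
    using diag_le_Max_spectrum[OF Mk Msym that] by (simp add: \<sigma>_max)
  have \<sigma>: "0 < \<sigma>_max" using M_pos[OF K(1)] M_le[OF K(1)] by simp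
  have \<beta>: "0 < \<beta>" using \<gamma>_pos U_N by (simp add: \<beta>_def)
  have \<beta>_le: "\<beta> * (s\<^sup>2 * \<sigma>_max) \<le> 1"
    using \<gamma>_bound U_N s \<sigma> by (simp add: \<beta>_def s_def field_simps)
  have \<beta>_less: "\<beta> * (s\<^sup>2 * \<sigma>_max) < 1" if "U_min\<^sup>2 = U_max\<^sup>2"
  proof -
    have "\<gamma> < U_N\<^sup>2 / (2 * (sin \<theta>)\<^sup>2 * \<sigma>_max)" using \<gamma>_bound \<gamma>_bound_degenerate[OF that] by simp
    then show ?thesis using U_N s \<sigma> by (simp add: \<beta>_def s_def field_simps)
  qed
  have diag_mono: "\<beta> * (s\<^sup>2 * M $$ (i, i)) \<le> \<beta> * (s\<^sup>2 * \<sigma>_max)" if "i < K" for i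
    using M_le[OF that] \<beta> by (intro mult_left_mono) auto

  have constraint: "\<Phi> *\<^sub>v x + b \<le> 0\<^sub>v (2 * (m - 1)) \<longleftrightarrow>
      (\<forall>i<K. b_min $ i \<le> s * (M *\<^sub>v x) $ i \<and> s * (M *\<^sub>v x) $ i \<le> b_max $ i)"
    if "x \<in> carrier_vec K" for x
    using append_rows_constraint_iff[OF Mk bk that] by (simp add: \<Phi> b s_def K_def)
  have q_opt: "q_opt \<in> carrier_vec K"
    and box: "\<And>i. i < K \<Longrightarrow> b_min $ i \<le> s * (M *\<^sub>v q_opt) $ i \<and> s * (M *\<^sub>v q_opt) $ i \<le> b_max $ i"
    using optimal constraint by (auto simp: is_arg_min_def K_def)
  have VI: "0 \<le> (v - s * (M *\<^sub>v q_opt) $ i) * ((q_opt $ i + c $ i) / s)"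
    if "i < K" "b_min $ i \<le> v" "v \<le> b_max $ i" for i v
    unfolding c_def
  proof (rule box_qp_variational_inequality[OF psd B(2,3) s d q_opt box _ that])
    fix y :: "real vec"
    assume "y \<in> carrier_vec K" "\<forall>i<K. b_min $ i \<le> s * (M *\<^sub>v y) $ i \<and> s * (M *\<^sub>v y) $ i \<le> b_max $ i"
    then show "1 / 2 * (q_opt \<bullet> (M *\<^sub>v q_opt)) + q_opt \<bullet> d \<le> 1 / 2 * (y \<bullet> (M *\<^sub>v y)) + y \<bullet> d"
      using optimal constraint[of y] by (auto simp: is_arg_min_def d_def K_def not_less)
  qed
  \<comment> \<open>The power terms cancel, so the box has the same width at all nodes and
    degenerates only if \<open>U_min\<^sup>2 = U_max\<^sup>2\<close>.\<close>
  have width: "b_max $ i - b_min $ i = (U_max\<^sup>2 - U_min\<^sup>2) / 2" if "i < K" for i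
    using that Mk Nk powers U_N unfolding b_min b_max v_min v_max
    by (simp add: ones_vec_def K_def field_simps)
  have nondegenerate: "\<beta> * (s\<^sup>2 * M $$ (i, i)) < 1 \<or> b_min $ i < b_max $ i" if "i < K" for i
  proof (cases "U_min\<^sup>2 = U_max\<^sup>2")
    case True
    then show ?thesis using diag_mono[OF that] \<beta>_less by simp
  next
    case False
    have "b_min $ i \<le> b_max $ i" using box[OF that] by linarith
    then show ?thesis using False width[OF that] by auto
  qed

  interpret prob_space P by (rule prob)
  have h_in: "h t \<omega> \<in> {1..<m}" if "\<omega> \<in> space P" for t \<omega>
  proof -
    have "h t \<in> measurable P (count_space {1..<m})" using h_indep by (simp add: indep_vars_def)
    from measurable_space[OF this that] show ?thesis by simp
  qed
  \<comment> \<open>The recurring word is 1, ..., m - 1; position \<open>i\<close> carries node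
    \<open>Suc i\<close>, whose vector entry is \<open>i\<close>.\<close>
  have "AE \<omega> in P. \<exists>\<^sub>\<infinity>t. \<forall>i<K. h (t + i) \<omega> = Suc i"
    using K(1) by (intro iid_uniform_word_infinitely_often[OF h_indep h_uniform]) (auto simp: K_def)
  with AE_space show ?thesis
  proof eventually_elim
    case (elim \<omega>)
    note \<omega> = \<open>\<omega> \<in> space P\<close>
    define k where "k t = h t \<omega> - 1" for t
    have h_eq: "h t \<omega> = Suc (k t)" and k: "k t < K" for t
      using h_in[OF \<omega>, of t] by (auto simp: k_def K_def)
    have dims: "q t \<omega> \<in> carrier_vec K" "lam_min t \<omega> \<in> carrier_vec K" "lam_max t \<omega> \<in> carrier_vec K" for t
      using state_dim[OF \<omega>] by (auto simp: K_def)
    have Mq: "s * (M *\<^sub>v q t \<omega>) $ i = s * (\<Sum>j<K. M $$ (i, j) * q t \<omega> $ j)" if "i < K" for t i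
      using mult_mat_vec_index_sum[OF Mk dims(1) that] by simp
    have entry: "unit_vec (m - Suc 0) (k t) \<bullet> v = v $ k t" if "v \<in> carrier_vec K" for t and v :: "real vec"
      using scalar_prod_left_unit[OF that k] by (simp add: K_def)
    have slack: "unit_vec (m - Suc 0) (k t) \<bullet> (b_min - sin \<theta> \<cdot>\<^sub>v (M *\<^sub>v q t \<omega>))
        = b_min $ k t - s * (M *\<^sub>v q t \<omega>) $ k t"
      "unit_vec (m - Suc 0) (k t) \<bullet> (sin \<theta> \<cdot>\<^sub>v (M *\<^sub>v q t \<omega>) - b_max)
        = s * (M *\<^sub>v q t \<omega>) $ k t - b_max $ k t" for t
    proof -
      have "M *\<^sub>v q t \<omega> \<in> carrier_vec K" using Mk dims by simp
      then show "unit_vec (m - Suc 0) (k t) \<bullet> (b_min - sin \<theta> \<cdot>\<^sub>v (M *\<^sub>v q t \<omega>))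
          = b_min $ k t - s * (M *\<^sub>v q t \<omega>) $ k t"
        "unit_vec (m - Suc 0) (k t) \<bullet> (sin \<theta> \<cdot>\<^sub>v (M *\<^sub>v q t \<omega>) - b_max)
          = s * (M *\<^sub>v q t \<omega>) $ k t - b_max $ k t"
        using bk k[of t] Mk by (simp_all add: entry s_def)
    qed
    have idle: "lam_min (Suc t) \<omega> $ i = lam_min t \<omega> $ i" "lam_max (Suc t) \<omega> $ i = lam_max t \<omega> $ i"
      "q (Suc t) \<omega> $ i = q t \<omega> $ i" if "i < K" "i \<noteq> k t" for t i
      using not_triggered[OF \<omega>, of "Suc i" t] that by (auto simp: h_eq K_def)
    have l_step: "lam_min (Suc t) \<omega> $ k t
        = max 0 (lam_min t \<omega> $ k t + \<beta> * (b_min $ k t - s * (M *\<^sub>v q t \<omega>) $ k t))" for t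
      using lam_min_update[OF \<omega>, of t] slack[of t] by (simp add: h_eq pos_part_def \<beta>_def)
    have u_step: "lam_max (Suc t) \<omega> $ k t
        = max 0 (lam_max t \<omega> $ k t + \<beta> * (s * (M *\<^sub>v q t \<omega>) $ k t - b_max $ k t))" for t
      using lam_max_update[OF \<omega>, of t] slack[of t] by (simp add: h_eq pos_part_def \<beta>_def)
    have q_step: "q (Suc t) \<omega> $ k t
        = s * (lam_min (Suc t) \<omega> $ k t - lam_max (Suc t) \<omega> $ k t) - c $ k t" for t
    proof -
      let ?\<mu> = "s \<cdot>\<^sub>v (lam_max (Suc t) \<omega> - lam_min (Suc t) \<omega>)"
      have \<mu>: "?\<mu> \<in> carrier_vec K" using dims by simp
      have "B *\<^sub>v (transpose_mat \<Phi> *\<^sub>v \<nu> (Suc t) \<omega>) = B *\<^sub>v (M *\<^sub>v ?\<mu>)"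
        using transpose_append_rows_mult_append[OF Mk Msym dims(2,3)] by (simp add: \<Phi> \<nu> s_def)
      also have "\<dots> = ?\<mu>"
        using \<mu> assoc_mult_mat_vec[OF B(2) Mk \<mu>] B(4) by simp
      finally have "q (Suc t) \<omega> $ k t = - (unit_vec (m - Suc 0) (k t) \<bullet> (c + ?\<mu>))"
        using q_update[OF \<omega>, of t] by (simp add: h_eq B(1) d_def[symmetric] c_def[symmetric])
      also have "\<dots> = - (c + ?\<mu>) $ k t"
        using c \<mu> by (subst entry) simp_all
      also have "\<dots> = s * (lam_min (Suc t) \<omega> $ k t - lam_max (Suc t) \<omega> $ k t) - c $ k t"
        using c dims[of "Suc t"] k[of t] by (simp add: right_diff_distrib)
      finally show ?thesis .
    qed
    have "(\<lambda>t. q t \<omega> $ i) \<longlonglongrightarrow> q_opt $ i" if i: "i < K" for i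
    proof (rule coordinate_ascent_pathwise[where K=K and M="\<lambda>i j. M $$ (i, j)" and k=k and s=s and \<beta>=\<beta> and C=C
          and lo="\<lambda>i. b_min $ i" and hi="\<lambda>i. b_max $ i" and c="\<lambda>i. c $ i"
          and l="\<lambda>t i. lam_min t \<omega> $ i" and u="\<lambda>t i. lam_max t \<omega> $ i"
          and wst="\<lambda>i. s * (\<Sum>j<K. M $$ (i, j) * q_opt $ j)"])
      have Mopt: "(\<Sum>j<K. M $$ (i, j) * q_opt $ j) = (M *\<^sub>v q_opt) $ i" if "i < K" for i
        using mult_mat_vec_index_sum[OF Mk q_opt that] by simp
      show "(x i)\<^sup>2 \<le> C * quad_form K (\<lambda>i j. M $$ (i, j)) x" if "i < K" for x i
        using C(2)[of "vec K x" i] that by (simp add: quad_form_mat_eq[OF Mk])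
      show "b_min $ i \<le> s * (\<Sum>j<K. M $$ (i, j) * q_opt $ j)" "s * (\<Sum>j<K. M $$ (i, j) * q_opt $ j) \<le> b_max $ i"
        if "i < K" for i using box[OF that] by (simp_all add: Mopt[OF that])
      show "0 \<le> (v - s * (\<Sum>j<K. M $$ (i, j) * q_opt $ j)) * ((q_opt $ i + c $ i) / s)"
        if "i < K" "b_min $ i \<le> v" "v \<le> b_max $ i" for i v
        using VI[OF that] by (simp add: Mopt[OF that(1)])
      show "0 \<le> M $$ (i, i)" if "i < K" for i using M_pos[OF that] by simp
      show "\<beta> * (s\<^sup>2 * M $$ (i, i)) \<le> 1" if "i < K" for i using diag_mono[OF that] \<beta>_le by simp
      show "\<exists>\<^sub>\<infinity>t. \<forall>i<K. k (t + i) = i" using elim by (simp add: h_eq)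
      show "lam_min (Suc t) \<omega> $ i = (if i = k t then max 0 (lam_min t \<omega> $ i + \<beta> * (b_min $ i
          - s * (\<Sum>j<K. M $$ (i, j) * q t \<omega> $ j))) else lam_min t \<omega> $ i)" if "i < K" for t i
        using l_step[of t] idle(1)[OF that, of t] Mq[OF that, of t] by auto
      show "lam_max (Suc t) \<omega> $ i = (if i = k t then max 0 (lam_max t \<omega> $ i + \<beta> *
          (s * (\<Sum>j<K. M $$ (i, j) * q t \<omega> $ j) - b_max $ i)) else lam_max t \<omega> $ i)" if "i < K" for t i
        using u_step[of t] idle(2)[OF that, of t] Mq[OF that, of t] by auto
      show "q (Suc t) \<omega> $ i = (if i = k t then s * (lam_min (Suc t) \<omega> $ i - lam_max (Suc t) \<omega> $ i) - c $ i
          else q t \<omega> $ i)" if "i < K" for t i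
        using q_step[of t] idle(3)[OF that, of t] by auto
    qed (fact Mij C(1) \<beta> s nondegenerate refl k i)+
    then show ?case by (simp add: K_def)
  qed
qed

end
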